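(* Let $K$ be a partition of $X$ parametrized by $(T,\mathcal A,\phi)$ and let $g\in\mathcal G(T)$ be a weight function. Then the following three conditions are equivalent: (1) There exists $M\ge 1$ such that the following holds: there exist $d\in\mathcal D(X,\mathcal O)$ and $\alpha>0$ such that $d$ is $M$-adapted to $g^{\alpha}$. (2) $g$ is hyperbolic, i.e. the rearranged resolution $(\widetilde T^{g,r},\mathcal B_{\widetilde T^{g,r}})$ is hyperbolic for some $r\in(0,1)$. (3) $(\widetilde T^{g,r},\mathcal B_{\widetilde T^{g,r}})$ is hyperbolic for every $r\in(0,1)$. Moreover, suppose any of these conditions is satisfied. Then for $M\ge1$ as in (1) and $r\in(0,1)$ there exist $c_1,c_2>0$ such that $$c_1\,\delta^g_M(x,y)\le r^{(x|y)_{\widetilde T^{g,r}}}\le c_2\,\delta^g_M(x,y)$$ for any $x,y\in X$, where $$(x|y)_{\widetilde T^{g,r}}=\sup\Big\{\lim_{n,m\to\infty}(\omega(n)|\tau(m))\ \Big|\ \omega=(\phi,\omega(1),\ldots),\ \tau=(\phi,\tau(1),\ldots)\in\Sigma_{\widetilde T^{g,r}},\ \sigma_{\widetilde T^{g,r}}(\omega)=x,\ \sigma_{\widetilde T^{g,r}}(\tau)=y\Big\}$$ and $(\cdot|\cdot)$ is the Gromov product in $(\widetilde T^{g,r},\mathcal B_{\widetilde T^{g,r}})$ with respect to $\phi$ (with $r^{\infty}=0$).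
   Context: Setting. $T$ is a countably infinite set, $\mathcal A:T\times T\to\{0,1\}$ is symmetric and vanishes on the diagonal, the graph on $T$ with edges $\{(w,v):\mathcal A(w,v)=1\}$ is a locally finite tree, and $\phi\in T$ is a fixed root. For $w\in T$: $|w|$ is the tree distance from $\phi$ to $w$; $(T)_m=\{w:|w|=m\}$; $\pi(w)$ is the neighbour of $w$ on the geodesic from $\phi$ to $w$ ($\pi(\phi)=\phi$); $S(w)$ is the set of neighbours of $w$ other than $\pi(w)$; $T_w$ is the set of $v\in T$ such that $w$ lies on the geodesic from $\phi$ to $v$. $\Sigma$ is the set of infinite geodesic rays $\omega=([\omega]_0=\phi,[\omega]_1,[\omega]_2,\ldots)$ of the tree starting at $\phi$. $(X,\mathcal O)$ is a compact metrizable topological space with no isolated point. A partition $K$ of $X$ parametrized by $(T,\mathcal A,\phi)$ assigns to each $w\in T$ a nonempty compact set $K_w\subseteq X$ such that $K_\phi=X$, $K_w=\bigcup_{v\in S(w)}K_v$ for all $w$, and $\bigcap_{m\ge0}K_{[\omega]_m}$ is a single point for every $\omega\in\Sigma$. Weight functions. A weight function is $g:T\to(0,1]$ with $g(\phi)=1$, $g(\pi(w))\ge g(w)$ for all $w$, and $\lim_{m\to\infty}\sup_{w\in(T)_m}g(w)=0$; $\mathcal G(T)$ is the set of weight functions. For $s\in(0,1)$, $\Lambda^g_s=\{w\in T: g(\pi(w))>s\ge g(w)\}$; for $s\ge1$, $\Lambda^g_s=\{\phi\}$. For an integer $M\ge0$, $x\in X$, $s>0$, $U^g_M(x,s)$ is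 the set of $y\in X$ for which there are $w(1),\ldots,w(M+1)\in\Lambda^g_s$ with $x\in K_{w(1)}$, $y\in K_{w(M+1)}$ and $K_{w(i)}\cap K_{w(i+1)}\ne\emptyset$ for $1\le i\le M$ (so $U^g_M(x,s)=X$ for $s\ge1$). $\delta^g_M(x,y)=\inf\{s\in(0,1]:y\in U^g_M(x,s)\}$. $\mathcal D(X,\mathcal O)$ is the set of metrics $d$ on $X$ inducing $\mathcal O$ with $\operatorname{diam}(X,d)=1$; $B_d(x,r)=\{y:d(x,y)<r\}$. $d\in\mathcal D(X,\mathcal O)$ is $M$-adapted to $g$ if there are $\alpha_1,\alpha_2>0$ with $U^g_M(x,\alpha_1r)\subseteq B_d(x,r)\subseteq U^g_M(x,\alpha_2r)$ for all $x\in X$, $r>0$. Rearranged resolution. For $r\in(0,1)$ let $(\widetilde T^{g,r})_m=\Lambda^g_{r^m}$ and $\widetilde T^{g,r}=\bigcup_{m\ge0}(\widetilde T^{g,r})_m$, understood as the disjoint union $\bigcup_m\{m\}\times\Lambda^g_{r^m}$. It is a tree with root $\phi$: for $w\in\Lambda^g_{r^{m+1}}$, its parent $\pi^{g,r}(w)$ is the unique $v\in\Lambda^g_{r^m}$ with $w\in T_v$. $\Sigma_{\widetilde T^{g,r}}$ is the set of geodesic rays $(\phi,\omega(1),\omega(2),\ldots)$ of this tree from $\phi$, and $\sigma_{\widetilde T^{g,r}}(\omega)$ is the unique point of $\bigcap_mK_{\omega(m)}$. The graph $(\widetilde T^{g,r},\mathcal B_{\widetilde T^{g,r}})$ has vertex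 set $\widetilde T^{g,r}$ and as edges the parent-child pairs and the pairs $(w,v)$ with $w,v\in(\widetilde T^{g,r})_n$ for some $n\ge1$ and $K_w\cap K_v\neq\emptyset$. Hyperbolicity. For a connected graph with graph distance $\mathsf d$ and root $\phi$, the Gromov product is $(w|v)=\frac12(\mathsf d(\phi,w)+\mathsf d(\phi,v)-\mathsf d(w,v))$, and the graph is hyperbolic if there is $\eta\in\mathbb R$ with $(w|v)\ge\min\{(w|u),(u|v)\}-\eta$ for all vertices $w,v,u$. *)

theory Defs
  imports "HOL-Analysis.Analysis"
begin

section \<open>Graphs\<close>

text \<open>A graph is a vertex set \<open>V\<close> together with a symmetric relation \<open>E\<close>, of which only the
  restriction to \<open>V\<close> matters. A path is the nonempty list of its vertices. (The predicates
  \<open>forest\<close> and \<open>tree\<close> of the AFP entry \<open>Graph_Theory\<close> are of no use here: they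
  concern directed graphs, where every symmetric pair of arcs is a cycle.)\<close>

definition path_between :: "'v set \<Rightarrow> ('v \<Rightarrow> 'v \<Rightarrow> bool) \<Rightarrow> 'v \<Rightarrow> 'v \<Rightarrow> 'v list \<Rightarrow> bool" where
  "path_between V E u v p \<longleftrightarrow>
     p \<noteq> [] \<and> set p \<subseteq> V \<and> hd p = u \<and> last p = v \<and> successively E p"

definition is_tree :: "'v set \<Rightarrow> ('v \<Rightarrow> 'v \<Rightarrow> bool) \<Rightarrow> bool" where
  "is_tree V E \<longleftrightarrow> (\<forall>u\<in>V. \<forall>v\<in>V. \<exists>!p. path_between V E u v p \<and> distinct p)"

definition locally_finite_graph :: "'v set \<Rightarrow> ('v \<Rightarrow> 'v \<Rightarrow> bool) \<Rightarrow> bool" where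
  "locally_finite_graph V E \<longleftrightarrow> (\<forall>w\<in>V. finite {v \<in> V. E w v})"

text \<open>The value is meaningful only if \<open>u\<close> and \<open>v\<close> are joined by a path; all graphs
  below are connected.\<close>

definition graph_dist :: "'v set \<Rightarrow> ('v \<Rightarrow> 'v \<Rightarrow> bool) \<Rightarrow> 'v \<Rightarrow> 'v \<Rightarrow> nat" where
  "graph_dist V E u v = (LEAST n. \<exists>p. path_between V E u v p \<and> length p = Suc n)"

definition is_geodesic :: "'v set \<Rightarrow> ('v \<Rightarrow> 'v \<Rightarrow> bool) \<Rightarrow> 'v \<Rightarrow> 'v \<Rightarrow> 'v list \<Rightarrow> bool" where
  "is_geodesic V E u v p \<longleftrightarrow> path_between V E u v p \<and> length p = Suc (graph_dist V E u v)"

definition geodesic_rays :: "'v set \<Rightarrow> ('v \<Rightarrow> 'v \<Rightarrow> bool) \<Rightarrow> 'v \<Rightarrow> (nat \<Rightarrow> 'v) set" where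
  "geodesic_rays V E \<phi> =
     {\<omega>. \<omega> 0 = \<phi> \<and> (\<forall>m n. m \<le> n \<longrightarrow> is_geodesic V E (\<omega> m) (\<omega> n) (map \<omega> [m..<Suc n]))}"

definition gromov_product ::
  "'v set \<Rightarrow> ('v \<Rightarrow> 'v \<Rightarrow> bool) \<Rightarrow> 'v \<Rightarrow> 'v \<Rightarrow> 'v \<Rightarrow> real" where
  "gromov_product V E \<phi> w v =
     (real (graph_dist V E \<phi> w) + real (graph_dist V E \<phi> v) - real (graph_dist V E w v)) / 2"

definition hyperbolic_graph :: "'v set \<Rightarrow> ('v \<Rightarrow> 'v \<Rightarrow> bool) \<Rightarrow> 'v \<Rightarrow> bool" where
  "hyperbolic_graph V E \<phi> \<longleftrightarrow>
     (\<exists>\<eta>::real. \<forall>w\<in>V. \<forall>v\<in>V. \<forall>u\<in>V.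
        gromov_product V E \<phi> w v
          \<ge> min (gromov_product V E \<phi> w u) (gromov_product V E \<phi> u v) - \<eta>)"

section \<open>The reference tree\<close>

abbreviation adj :: "('t \<Rightarrow> 't \<Rightarrow> nat) \<Rightarrow> 't \<Rightarrow> 't \<Rightarrow> bool" where
  "adj A \<equiv> \<lambda>w v. A w v = 1"

definition reference_tree :: "'t set \<Rightarrow> ('t \<Rightarrow> 't \<Rightarrow> nat) \<Rightarrow> 't \<Rightarrow> bool" where
  "reference_tree T A \<phi> \<longleftrightarrow>
     countable T \<and> infinite T \<and>
     (\<forall>w\<in>T. \<forall>v\<in>T. A w v \<in> {0, 1} \<and> A w v = A v w) \<and> (\<forall>w\<in>T. A w w = 0) \<and>
     is_tree T (adj A) \<and> locally_finite_graph T (adj A) \<and> \<phi> \<in> T"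

definition level :: "'t set \<Rightarrow> ('t \<Rightarrow> 't \<Rightarrow> nat) \<Rightarrow> 't \<Rightarrow> nat \<Rightarrow> 't set" where
  "level T A \<phi> m = {w \<in> T. graph_dist T (adj A) \<phi> w = m}"

definition parent :: "'t set \<Rightarrow> ('t \<Rightarrow> 't \<Rightarrow> nat) \<Rightarrow> 't \<Rightarrow> 't \<Rightarrow> 't" where
  "parent T A \<phi> w =
     (if w = \<phi> then \<phi>
      else (THE v. A w v = 1 \<and> (\<exists>p. is_geodesic T (adj A) \<phi> w p \<and> v \<in> set p)))"

definition children :: "'t set \<Rightarrow> ('t \<Rightarrow> 't \<Rightarrow> nat) \<Rightarrow> 't \<Rightarrow> 't \<Rightarrow> 't set" where
  "children T A \<phi> w = {v \<in> T. A w v = 1 \<and> v \<noteq> parent T A \<phi> w}"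

definition subtree :: "'t set \<Rightarrow> ('t \<Rightarrow> 't \<Rightarrow> nat) \<Rightarrow> 't \<Rightarrow> 't \<Rightarrow> 't set" where
  "subtree T A \<phi> w = {v \<in> T. \<exists>p. is_geodesic T (adj A) \<phi> v p \<and> w \<in> set p}"

section \<open>Partitions and weight functions\<close>

definition partition_of ::
  "'x topology \<Rightarrow> 't set \<Rightarrow> ('t \<Rightarrow> 't \<Rightarrow> nat) \<Rightarrow> 't \<Rightarrow> ('t \<Rightarrow> 'x set) \<Rightarrow> bool" where
  "partition_of X T A \<phi> K \<longleftrightarrow>
     (\<forall>w\<in>T. K w \<noteq> {} \<and> compactin X (K w)) \<and>
     K \<phi> = topspace X \<and>
     (\<forall>w\<in>T. K w = (\<Union>v\<in>children T A \<phi> w. K v)) \<and>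
     (\<forall>\<omega>\<in>geodesic_rays T (adj A) \<phi>. \<exists>x. (\<Inter>m. K (\<omega> m)) = {x})"

definition weight_functions ::
  "'t set \<Rightarrow> ('t \<Rightarrow> 't \<Rightarrow> nat) \<Rightarrow> 't \<Rightarrow> ('t \<Rightarrow> real) set" where
  "weight_functions T A \<phi> =
     {g. (\<forall>w\<in>T. 0 < g w \<and> g w \<le> 1) \<and> g \<phi> = 1 \<and>
         (\<forall>w\<in>T. g (parent T A \<phi> w) \<ge> g w) \<and>
         (\<lambda>m. SUP w\<in>level T A \<phi> m. g w) \<longlonglongrightarrow> 0}"

definition scale ::
  "'t set \<Rightarrow> ('t \<Rightarrow> 't \<Rightarrow> nat) \<Rightarrow> 't \<Rightarrow> ('t \<Rightarrow> real) \<Rightarrow> real \<Rightarrow> 't set" where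
  "scale T A \<phi> g s =
     (if s \<ge> 1 then {\<phi>} else {w \<in> T. g (parent T A \<phi> w) > s \<and> s \<ge> g w})"

definition chain_nbhd ::
  "'x topology \<Rightarrow> 't set \<Rightarrow> ('t \<Rightarrow> 't \<Rightarrow> nat) \<Rightarrow> 't \<Rightarrow> ('t \<Rightarrow> 'x set) \<Rightarrow> ('t \<Rightarrow> real)
     \<Rightarrow> nat \<Rightarrow> 'x \<Rightarrow> real \<Rightarrow> 'x set" where
  "chain_nbhd X T A \<phi> K g M x s =
     {y \<in> topspace X. \<exists>w :: nat \<Rightarrow> 't.
        (\<forall>i\<in>{1..M+1}. w i \<in> scale T A \<phi> g s) \<and> x \<in> K (w 1) \<and> y \<in> K (w (M+1)) \<and>
        (\<forall>i\<in>{1..M}. K (w i) \<inter> K (w (i+1)) \<noteq> {})}"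

definition delta ::
  "'x topology \<Rightarrow> 't set \<Rightarrow> ('t \<Rightarrow> 't \<Rightarrow> nat) \<Rightarrow> 't \<Rightarrow> ('t \<Rightarrow> 'x set) \<Rightarrow> ('t \<Rightarrow> real)
     \<Rightarrow> nat \<Rightarrow> 'x \<Rightarrow> 'x \<Rightarrow> real" where
  "delta X T A \<phi> K g M x y = Inf {s \<in> {0<..1}. y \<in> chain_nbhd X T A \<phi> K g M x s}"

definition unit_metrics :: "'x topology \<Rightarrow> ('x \<Rightarrow> 'x \<Rightarrow> real) set" where
  "unit_metrics X =
     {d. Metric_space (topspace X) d \<and> Metric_space.mtopology (topspace X) d = X \<and>
         (SUP (x, y)\<in>topspace X \<times> topspace X. d x y) = 1}"

definition adapted ::
  "'x topology \<Rightarrow> 't set \<Rightarrow> ('t \<Rightarrow> 't \<Rightarrow> nat) \<Rightarrow> 't \<Rightarrow> ('t \<Rightarrow> 'x set)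
     \<Rightarrow> nat \<Rightarrow> ('x \<Rightarrow> 'x \<Rightarrow> real) \<Rightarrow> ('t \<Rightarrow> real) \<Rightarrow> bool" where
  "adapted X T A \<phi> K M d g \<longleftrightarrow>
     (\<exists>\<alpha>\<^sub>1>0. \<exists>\<alpha>\<^sub>2>0. \<forall>x\<in>topspace X. \<forall>r>0.
        chain_nbhd X T A \<phi> K g M x (\<alpha>\<^sub>1 * r) \<subseteq> Metric_space.mball (topspace X) d x r \<and>
        Metric_space.mball (topspace X) d x r \<subseteq> chain_nbhd X T A \<phi> K g M x (\<alpha>\<^sub>2 * r))"

section \<open>The rearranged resolution\<close>

text \<open>Its vertices are pairs (level, element of \<open>T\<close>), since the same element of \<open>T\<close> may
  occur at several levels. The root is \<open>(0, \<phi>)\<close>.\<close>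

definition resolution ::
  "'t set \<Rightarrow> ('t \<Rightarrow> 't \<Rightarrow> nat) \<Rightarrow> 't \<Rightarrow> ('t \<Rightarrow> real) \<Rightarrow> real \<Rightarrow> (nat \<times> 't) set" where
  "resolution T A \<phi> g r = (SIGMA m:UNIV. scale T A \<phi> g (r ^ m))"

definition res_parent ::
  "'t set \<Rightarrow> ('t \<Rightarrow> 't \<Rightarrow> nat) \<Rightarrow> 't \<Rightarrow> ('t \<Rightarrow> real) \<Rightarrow> real \<Rightarrow> nat \<Rightarrow> 't \<Rightarrow> 't" where
  \<comment> \<open>the parent of \<open>(m + 1, w)\<close> is \<open>(m, res_parent T A \<phi> g r m w)\<close>\<close>
  "res_parent T A \<phi> g r m w =
     (THE v. v \<in> scale T A \<phi> g (r ^ m) \<and> w \<in> subtree T A \<phi> v)"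

definition res_child ::
  "'t set \<Rightarrow> ('t \<Rightarrow> 't \<Rightarrow> nat) \<Rightarrow> 't \<Rightarrow> ('t \<Rightarrow> real) \<Rightarrow> real
     \<Rightarrow> nat \<times> 't \<Rightarrow> nat \<times> 't \<Rightarrow> bool" where
  \<comment> \<open>\<open>b\<close> is a child of \<open>a\<close>\<close>
  "res_child T A \<phi> g r a b \<longleftrightarrow>
     fst b = Suc (fst a) \<and> snd a = res_parent T A \<phi> g r (fst a) (snd b)"

definition res_tree_edge ::
  "'t set \<Rightarrow> ('t \<Rightarrow> 't \<Rightarrow> nat) \<Rightarrow> 't \<Rightarrow> ('t \<Rightarrow> real) \<Rightarrow> real
     \<Rightarrow> nat \<times> 't \<Rightarrow> nat \<times> 't \<Rightarrow> bool" where
  "res_tree_edge T A \<phi> g r a b \<longleftrightarrow> res_child T A \<phi> g r a b \<or> res_child T A \<phi> g r b a"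

text \<open>The second disjunct includes the loops \<open>a = b\<close>, which do not affect distances.\<close>

definition res_edge ::
  "'t set \<Rightarrow> ('t \<Rightarrow> 't \<Rightarrow> nat) \<Rightarrow> 't \<Rightarrow> ('t \<Rightarrow> 'x set) \<Rightarrow> ('t \<Rightarrow> real) \<Rightarrow> real
     \<Rightarrow> nat \<times> 't \<Rightarrow> nat \<times> 't \<Rightarrow> bool" where
  "res_edge T A \<phi> K g r a b \<longleftrightarrow>
     res_tree_edge T A \<phi> g r a b \<or>
     fst a = fst b \<and> fst a \<ge> 1 \<and> K (snd a) \<inter> K (snd b) \<noteq> {}"

definition hyperbolic_resolution ::
  "'t set \<Rightarrow> ('t \<Rightarrow> 't \<Rightarrow> nat) \<Rightarrow> 't \<Rightarrow> ('t \<Rightarrow> 'x set) \<Rightarrow> ('t \<Rightarrow> real) \<Rightarrow> real \<Rightarrow> bool" where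
  "hyperbolic_resolution T A \<phi> K g r \<longleftrightarrow>
     hyperbolic_graph (resolution T A \<phi> g r) (res_edge T A \<phi> K g r) (0, \<phi>)"

definition hyperbolic_weight ::
  "'t set \<Rightarrow> ('t \<Rightarrow> 't \<Rightarrow> nat) \<Rightarrow> 't \<Rightarrow> ('t \<Rightarrow> 'x set) \<Rightarrow> ('t \<Rightarrow> real) \<Rightarrow> bool" where
  "hyperbolic_weight T A \<phi> K g \<longleftrightarrow> (\<exists>r\<in>{0<..<1}. hyperbolic_resolution T A \<phi> K g r)"

definition res_rays ::
  "'t set \<Rightarrow> ('t \<Rightarrow> 't \<Rightarrow> nat) \<Rightarrow> 't \<Rightarrow> ('t \<Rightarrow> real) \<Rightarrow> real \<Rightarrow> (nat \<Rightarrow> nat \<times> 't) set" where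
  "res_rays T A \<phi> g r = geodesic_rays (resolution T A \<phi> g r) (res_tree_edge T A \<phi> g r) (0, \<phi>)"

definition ray_point :: "('t \<Rightarrow> 'x set) \<Rightarrow> (nat \<Rightarrow> nat \<times> 't) \<Rightarrow> 'x" where
  "ray_point K \<omega> = the_elem (\<Inter>m. K (snd (\<omega> m)))"

text \<open>The limit exists in \<open>[0, \<infinity>]\<close>, because \<open>(\<omega>(n)|\<tau>(m))\<close> is nondecreasing in
  \<open>n\<close> and in \<open>m\<close>.\<close>

definition boundary_product ::
  "'t set \<Rightarrow> ('t \<Rightarrow> 't \<Rightarrow> nat) \<Rightarrow> 't \<Rightarrow> ('t \<Rightarrow> 'x set) \<Rightarrow> ('t \<Rightarrow> real) \<Rightarrow> real
     \<Rightarrow> 'x \<Rightarrow> 'x \<Rightarrow> ereal" where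
  "boundary_product T A \<phi> K g r x y =
     Sup {Lim (sequentially \<times>\<^sub>F sequentially)
            (\<lambda>(n, m). ereal (gromov_product (resolution T A \<phi> g r) (res_edge T A \<phi> K g r)
                               (0, \<phi>) (\<omega> n) (\<tau> m))) | \<omega> \<tau>.
          \<omega> \<in> res_rays T A \<phi> g r \<and> \<tau> \<in> res_rays T A \<phi> g r \<and>
          ray_point K \<omega> = x \<and> ray_point K \<tau> = y}"

definition epowr :: "real \<Rightarrow> ereal \<Rightarrow> real" where
  "epowr r t = (if t = \<infinity> then 0 else r powr real_of_ereal t)"

end

theory Submission
  imports Defs
begin

text \<open>
  Write \<open>h_k(w, v)\<close> for the length of the shortest chain of pairwise consecutively meeting
  cells of \<open>\<Lambda>_(r^k)\<close> from \<open>w\<close> to \<open>v\<close>. Pushing walks up to the lowest level they visit shows that the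
  Gromov product of two vertices of the resolution is the maximum of \<open>k - h_k/2\<close> over their
  pairs of ancestors at common levels \<open>k\<close>, and hence that \<open>(x|y)\<close> is the supremum of \<open>k - h/2\<close> over
  all chains of length \<open>h\<close> at level \<open>k\<close> joining \<open>x\<close> to \<open>y\<close>.

  If \<open>d\<close> is adapted to \<open>g^\<alpha>\<close>, such a chain gives \<open>d(x, y) \<le> const (h + 1) r^(\<alpha> k) \<le> const r^(\<alpha> (k - h/2))\<close>,
  while conversely \<open>d(x, y) \<le> const r^(\<alpha> t)\<close> gives a chain of length \<open>M\<close> at a level \<open>\<ge> t - const\<close>. The
  triangle inequality for \<open>d\<close> thus becomes hyperbolicity, and the same two estimates compare
  \<open>r^(x|y)\<close> with \<open>\<delta>_M\<close>.

  If the resolution is \<open>\<eta>\<close>-hyperbolic, a chain of length \<open>2^p\<close> at level \<open>k\<close> has Gromov product at least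
  \<open>k - 1/2 - p \<eta>\<close>, so that at some level \<open>\<ge> k - 1/2 - p \<eta>\<close> its ends are joined by a chain of length
  \<open>M \<le> 1 + 2 p \<eta>\<close>. For large \<open>p\<close> we have \<open>3 M + 2 \<le> 2^p\<close>, so \<open>\<delta>_M\<close> is a quasi-ultrametric, and a small
  power of it is comparable to a metric by Frink's lemma.
\<close>

section \<open>Walks as relational powers, geodesics and rays\<close>

section \<open>Walks\<close>

text \<open>A walk of length \<open>n\<close> becomes a pair in \<open>steps V E ^^ n\<close>, so
  that concatenation, reversal and monotonicity come from the algebra of relations instead of
  manipulations of vertex lists.\<close>

definition steps :: "'v set \<Rightarrow> ('v \<Rightarrow> 'v \<Rightarrow> bool) \<Rightarrow> ('v \<times> 'v) set" where
  "steps V E = {(a, b). a \<in> V \<and> b \<in> V \<and> E a b}"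

lemma path_between_snoc:
  assumes "p \<noteq> []"
  shows "path_between V E u v (p @ [v]) \<longleftrightarrow> path_between V E u (last p) p \<and> v \<in> V \<and> E (last p) v"
  using assms by (auto simp: path_between_def successively_append_iff)

text \<open>Both sides grow by one vertex at the end; \<open>n\<close> counts edges and the list has
  one entry more. The hypothesis \<open>u \<in> V\<close> serves \<open>n = 0\<close>, where the
  relational power is the full identity.\<close>

lemma path_between_iff_relpow:
  assumes "u \<in> V"
  shows "(\<exists>p. path_between V E u v p \<and> length p = Suc n) \<longleftrightarrow> (u, v) \<in> steps V E ^^ n"
proof (induction n arbitrary: v)
  case 0
  have "path_between V E u v p \<and> length p = Suc 0 \<longleftrightarrow> p = [u] \<and> u = v" for p
    using assms by (auto simp: path_between_def length_Suc_conv)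
  then show ?case by auto
next
  case (Suc n)
  have "(\<exists>p. path_between V E u v p \<and> length p = Suc (Suc n)) \<longleftrightarrow>
        (\<exists>z. (\<exists>p. path_between V E u z p \<and> length p = Suc n) \<and> (z, v) \<in> steps V E)" (is "?L \<longleftrightarrow> ?R")
  proof
    assume ?L
    then obtain p where p: "path_between V E u v p" "length p = Suc (Suc n)" by blast
    then obtain q z where q: "p = q @ [z]" by (metis length_0_conv nat.simps(3) rev_exhaust)
    moreover have "z = v" using p q by (auto simp: path_between_def)
    ultimately have "q \<noteq> []" "p = q @ [v]" using p by auto
    with p have "path_between V E u (last q) q" "v \<in> V" "E (last q) v" "length q = Suc n"
      using path_between_snoc by fastforce+
    moreover have "last q \<in> V" using calculation \<open>q \<noteq> []\<close> by (auto simp: path_between_def)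
    ultimately show ?R unfolding steps_def by blast
  next
    assume ?R
    then obtain z p where p: "path_between V E u z p" "length p = Suc n" "(z, v) \<in> steps V E" by blast
    then have "p \<noteq> []" "last p = z" by (auto simp: path_between_def)
    with p have "path_between V E u v (p @ [v])"
      unfolding path_between_snoc[OF \<open>p \<noteq> []\<close>] by (auto simp: steps_def)
    with p show ?L by (intro exI[of _ "p @ [v]"]) auto
  qed
  then show ?case using Suc by auto
qed

lemma graph_dist_eq_Least_relpow:
  assumes "u \<in> V"
  shows "graph_dist V E u v = (LEAST n. (u, v) \<in> steps V E ^^ n)"
  using path_between_iff_relpow[OF assms] by (simp add: graph_dist_def)

lemma graph_dist_le:
  assumes "u \<in> V" "(u, v) \<in> steps V E ^^ n"
  shows "graph_dist V E u v \<le> n"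
  using assms by (simp add: graph_dist_eq_Least_relpow Least_le)

lemma relpow_graph_dist:
  assumes "u \<in> V" "(u, v) \<in> steps V E ^^ n"
  shows "(u, v) \<in> steps V E ^^ graph_dist V E u v"
  using assms by (simp add: graph_dist_eq_Least_relpow) (rule LeastI)

lemma relpow_mono_rel: "(a, b) \<in> R ^^ n \<Longrightarrow> R \<subseteq> R' \<Longrightarrow> (a, b) \<in> R' ^^ n" for R R' :: "('a \<times> 'a) set"
  by (induction n arbitrary: b) auto

lemma relpow_sym:
  assumes "sym R" "(a, b) \<in> R ^^ n"
  shows "(b, a) \<in> R ^^ n"
  using assms(2)
proof (induction n arbitrary: b)
  case (Suc n)
  then obtain c where "(a, c) \<in> R ^^ n" "(c, b) \<in> R" by auto
  with Suc.IH symD[OF assms(1)] show ?case by (blast intro: relpow_Suc_I2)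
qed simp

text \<open>A function that rises by at most one along each edge bounds the length of walks from
  below; depth and level are used in this role.\<close>

lemma relpow_potential_le:
  fixes f :: "'v \<Rightarrow> nat"
  assumes "\<And>a b. \<lbrakk>a \<in> V; b \<in> V; E a b\<rbrakk> \<Longrightarrow> f b \<le> Suc (f a)"
    and "(u, v) \<in> steps V E ^^ n"
  shows "f v \<le> f u + n"
  using assms(2)
proof (induction n arbitrary: v)
  case (Suc n)
  then obtain z where z: "(u, z) \<in> steps V E ^^ n" "(z, v) \<in> steps V E" by auto
  then have "f v \<le> Suc (f z)" using assms(1) by (auto simp: steps_def)
  with Suc.IH[OF z(1)] show ?case by simp
qed auto

text \<open>\<open>f\<close> calibrates \<open>\<omega>\<close>: it gains exactly one per step of
  \<open>\<omega>\<close> and no edge gains more, so no walk between two points of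
  \<open>\<omega>\<close> is shorter than the segment of \<open>\<omega>\<close>.\<close>

lemma geodesic_raysI:
  fixes f :: "'v \<Rightarrow> nat"
  assumes lip: "\<And>a b. \<lbrakk>a \<in> V; b \<in> V; E a b\<rbrakk> \<Longrightarrow> f b \<le> Suc (f a)"
    and \<omega>: "\<omega> 0 = \<phi>" "\<And>n. \<omega> n \<in> V" "\<And>n. E (\<omega> n) (\<omega> (Suc n))" "\<And>n. f (\<omega> n) = n"
  shows "\<omega> \<in> geodesic_rays V E \<phi>"
proof -
  have "is_geodesic V E (\<omega> m) (\<omega> n) (map \<omega> [m..<Suc n])" if "m \<le> n" for m n
  proof -
    have path: "path_between V E (\<omega> m) (\<omega> n) (map \<omega> [m..<Suc n])"
      using that \<omega>
      by (auto simp: path_between_def hd_map last_map successively_conv_nth nth_append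
          simp del: upt_Suc)
    then have rp: "(\<omega> m, \<omega> n) \<in> steps V E ^^ (n - m)"
      using path_between_iff_relpow[OF \<omega>(2)] that
      by (metis Suc_diff_le length_map length_upt)
    have "n \<le> m + graph_dist V E (\<omega> m) (\<omega> n)"
      using relpow_potential_le[of V E f, OF lip relpow_graph_dist[OF \<omega>(2) rp]] \<omega>(4) by simp
    moreover have "graph_dist V E (\<omega> m) (\<omega> n) \<le> n - m" using graph_dist_le[OF \<omega>(2) rp] .
    ultimately have "graph_dist V E (\<omega> m) (\<omega> n) = n - m" by linarith
    with path that show ?thesis by (simp add: is_geodesic_def Suc_diff_le)
  qed
  with \<omega>(1) show ?thesis by (simp add: geodesic_rays_def)
qed

lemma geodesic_rays_step:
  assumes "\<omega> \<in> geodesic_rays V E \<phi>"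
  shows "\<omega> 0 = \<phi>" "\<omega> n \<in> V" "E (\<omega> n) (\<omega> (Suc n))" "graph_dist V E \<phi> (\<omega> n) = n"
proof -
  show 0: "\<omega> 0 = \<phi>" using assms by (simp add: geodesic_rays_def)
  have geo: "is_geodesic V E (\<omega> m) (\<omega> n) (map \<omega> [m..<Suc n])" if "m \<le> n" for m n
    using assms that by (simp add: geodesic_rays_def)
  show "\<omega> n \<in> V" using geo[of n n] by (simp add: is_geodesic_def path_between_def)
  show "E (\<omega> n) (\<omega> (Suc n))" using geo[of n "Suc n"] by (simp add: is_geodesic_def path_between_def)
  show "graph_dist V E \<phi> (\<omega> n) = n" using geo[of 0 n] 0 by (simp add: is_geodesic_def)
qed

text \<open>The loop between two occurrences of a vertex could be cut out, leaving a shorter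
  path.\<close>

lemma distinct_geodesic:
  assumes "is_geodesic V E u v p"
  shows "distinct p"
proof (rule ccontr)
  assume "\<not> distinct p"
  then obtain xs ys zs a where p: "p = xs @ [a] @ ys @ [a] @ zs" using not_distinct_decomp by blast
  have path: "path_between V E u v p" and len: "length p = Suc (graph_dist V E u v)"
    using assms by (auto simp: is_geodesic_def)
  have "path_between V E u v (xs @ [a] @ zs)"
    using path unfolding p path_between_def
    by (auto simp: successively_append_iff successively_Cons hd_append last_append split: if_splits)
  then have "graph_dist V E u v \<le> length (xs @ [a] @ zs) - 1"
    unfolding graph_dist_def by (intro Least_le) auto
  with len show False unfolding p by simp
qed

lemma is_geodesic_exists:
  assumes "path_between V E u v p"
  shows "\<exists>q. is_geodesic V E u v q"
proof -
  have "\<exists>n p. path_between V E u v p \<and> length p = Suc n"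
    using assms by (metis path_between_def length_0_conv not0_implies_Suc)
  then have "\<exists>p. path_between V E u v p \<and> length p = Suc (graph_dist V E u v)"
    unfolding graph_dist_def by (rule LeastI_ex)
  then show ?thesis by (simp add: is_geodesic_def)
qed

section \<open>The chain metric of a quasi-ultrametric\<close>

section \<open>Metrization of quasi-ultrametrics\<close>

text \<open>Induction on the length: cut the chain at the last point where the partial sum is at most half
  of the total, so that both remaining parts have at most half of it.\<close>

lemma chain_sum_bound:
  fixes q :: "'a \<Rightarrow> 'a \<Rightarrow> real"
  assumes nn: "\<And>x y. \<lbrakk>x \<in> S; y \<in> S\<rbrakk> \<Longrightarrow> 0 \<le> q x y"
    and refl: "\<And>x. x \<in> S \<Longrightarrow> q x x = 0"
    and three: "\<And>x y z w. \<lbrakk>x \<in> S; y \<in> S; z \<in> S; w \<in> S\<rbrakk> \<Longrightarrow>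
                  q x w \<le> 2 * Max {q x y, q y z, q z w}"
    and u: "\<And>i. u i \<in> S" and "m \<le> n"
  shows "q (u m) (u n) \<le> 2 * (\<Sum>i=m..<n. q (u i) (u (Suc i)))"
  using \<open>m \<le> n\<close>
proof (induction "n - m" arbitrary: m n rule: less_induct)
  case less
  show ?case
  proof (cases "m = n")
    case True
    then show ?thesis using refl u by simp
  next
    case False
    define s where "s = (\<lambda>a b. \<Sum>i=a..<b. q (u i) (u (Suc i)))"
    have s_nn: "0 \<le> s a b" for a b unfolding s_def by (intro sum_nonneg nn u)
    define P where "P k \<longleftrightarrow> m \<le> k \<and> k < n \<and> s m k \<le> s m n / 2" for k
    have "P m" using False less.prems s_nn[of m n] by (simp add: P_def s_def)
    then obtain k where k: "P k" "\<And>j. P j \<Longrightarrow> j \<le> k"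
      using GreatestI_nat[of P m n] Greatest_le_nat[of P _ n] unfolding P_def
      by (metis (no_types, lifting) less_or_eq_imp_le)
    then have mk: "m \<le> k" "k < n" "s m k \<le> s m n / 2" by (auto simp: P_def)
    have split: "s m n = s m k + q (u k) (u (Suc k)) + s (Suc k) n"
    proof -
      have "s m n = s m k + s k n"
        using mk unfolding s_def by (simp add: sum.atLeastLessThan_concat)
      moreover have "s k n = q (u k) (u (Suc k)) + s (Suc k) n"
        using mk unfolding s_def by (simp add: sum.atLeast_Suc_lessThan)
      ultimately show ?thesis by simp
    qed
    have tail: "s (Suc k) n \<le> s m n / 2"
    proof (cases "Suc k = n")
      case True
      then show ?thesis using s_nn[of m n] by (simp add: s_def)
    next
      case False
      then have "\<not> P (Suc k)" using k(2)[of "Suc k"] by auto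
      then have "s m (Suc k) > s m n / 2" using False mk by (auto simp: P_def)
      moreover have "s m (Suc k) = s m k + q (u k) (u (Suc k))" using mk by (simp add: s_def)
      ultimately show ?thesis using split by linarith
    qed
    have "q (u m) (u k) \<le> 2 * s m k"
      unfolding s_def by (rule less.hyps) (use mk in auto)
    moreover have "q (u (Suc k)) (u n) \<le> 2 * s (Suc k) n"
      unfolding s_def by (rule less.hyps) (use mk in auto)
    moreover have "q (u k) (u (Suc k)) \<le> s m n" using split s_nn[of m k] s_nn[of "Suc k" n] by linarith
    \<comment> \<open>The outer parts cost twice a sum of at most half the total, the middle step at
      most the total. So the maximum is at most \<open>s m n\<close>, and \<open>three\<close> adds
      the factor 2 only once.\<close>
    ultimately have "Max {q (u m) (u k), q (u k) (u (Suc k)), q (u (Suc k)) (u n)} \<le> s m n"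
      using mk tail by simp
    with three[OF u u u u, of m n k "Suc k"] show ?thesis unfolding s_def by linarith
  qed
qed

text \<open>Frink's construction: \<open>d\<close> is the infimum of the \<open>q\<close>-lengths of
  finite chains. One-step chains give \<open>d \<le> q\<close>, \<open>chain_sum_bound\<close> gives
  \<open>q \<le> 2 * d\<close>, reversal gives symmetry and concatenation the triangle
  inequality.\<close>

lemma quasi_ultrametric_metrizable:
  fixes q :: "'a \<Rightarrow> 'a \<Rightarrow> real"
  assumes nn: "\<And>x y. \<lbrakk>x \<in> S; y \<in> S\<rbrakk> \<Longrightarrow> 0 \<le> q x y"
    and zero: "\<And>x y. \<lbrakk>x \<in> S; y \<in> S\<rbrakk> \<Longrightarrow> q x y = 0 \<longleftrightarrow> x = y"
    and sym: "\<And>x y. \<lbrakk>x \<in> S; y \<in> S\<rbrakk> \<Longrightarrow> q x y = q y x"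
    and three: "\<And>x y z w. \<lbrakk>x \<in> S; y \<in> S; z \<in> S; w \<in> S\<rbrakk> \<Longrightarrow>
                  q x w \<le> 2 * Max {q x y, q y z, q z w}"
  obtains d where "Metric_space S d"
    "\<And>x y. \<lbrakk>x \<in> S; y \<in> S\<rbrakk> \<Longrightarrow> d x y \<le> q x y"
    "\<And>x y. \<lbrakk>x \<in> S; y \<in> S\<rbrakk> \<Longrightarrow> q x y \<le> 2 * d x y"
proof -
  define len where "len u n = (\<Sum>i<n. q (u i) (u (Suc i)))" for u :: "nat \<Rightarrow> 'a" and n
  define C where "C x y = {len u n | u n. (\<forall>i. u i \<in> S) \<and> u 0 = x \<and> u n = y}" for x y
  \<comment> \<open>\<open>Metric_space\<close> asks for nonnegativity and symmetry at all
    arguments, so the discrete metric serves as a default outside \<open>S\<close>.\<close>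
  define d where "d x y = (if x \<in> S \<and> y \<in> S then Inf (C x y) else if x = y then 0 else 1)" for x y
  have lenC: "len u n \<in> C (u 0) (u n)" if "\<And>i. u i \<in> S" for u n
    unfolding C_def using that by blast
  have C_lower: "q x y / 2 \<le> c" if "c \<in> C x y" for c x y
  proof -
    from that obtain u n where u: "c = len u n" "\<And>i. u i \<in> S" "u 0 = x" "u n = y"
      unfolding C_def by auto
    show ?thesis
      using chain_sum_bound[of S q u 0 n] nn zero three u
      by (simp add: len_def lessThan_atLeast0)
  qed
  have C_q: "q x y \<in> C x y" if "x \<in> S" "y \<in> S" for x y
    using lenC[of "\<lambda>i. if i = 0 then x else y" 1] that by (simp add: len_def)
  have bdd: "bdd_below (C x y)" for x y using C_lower by (rule bdd_belowI)
  have upper: "d x y \<le> q x y" if "x \<in> S" "y \<in> S" for x y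
    using that C_q bdd by (simp add: d_def cInf_lower)
  have lower: "q x y \<le> 2 * d x y" if "x \<in> S" "y \<in> S" for x y
  proof -
    have "q x y / 2 \<le> Inf (C x y)" using C_lower C_q[OF that] by (intro cInf_greatest) auto
    then show ?thesis using that by (simp add: d_def)
  qed
  have C_rev: "c \<in> C y x" if "c \<in> C x y" for c x y
  proof -
    from that obtain u n where u: "c = len u n" "\<And>i. u i \<in> S" "u 0 = x" "u n = y"
      unfolding C_def by auto
    have "len (\<lambda>i. u (n - i)) n = (\<Sum>i<n. q (u (Suc (n - Suc i))) (u (n - Suc i)))"
      unfolding len_def by (intro sum.cong) (auto simp: Suc_diff_Suc)
    also have "\<dots> = (\<Sum>i<n. q (u (Suc i)) (u i))"
      by (rule sum.nat_diff_reindex)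
    also have "\<dots> = c" using u sym by (simp add: len_def)
    finally show ?thesis using lenC[of "\<lambda>i. u (n - i)" n] u by simp
  qed
  have C_sym: "C x y = C y x" for x y using C_rev by blast
  have C_add: "a + b \<in> C x z" if "a \<in> C x y" "b \<in> C y z" for a b x y z
  proof -
    from that obtain u n v m where u: "a = len u n" "\<And>i. u i \<in> S" "u 0 = x" "u n = y"
      and v: "b = len v m" "\<And>i. v i \<in> S" "v 0 = y" "v m = z"
      unfolding C_def by auto
    define w where "w i = (if i < n then u i else v (i - n))" for i
    have "(\<Sum>i<n + k. F i) = (\<Sum>i<n. F i) + (\<Sum>i<k. F (n + i))" for F :: "nat \<Rightarrow> real" and k
      by (induction k) auto
    then have "len w (n + m) = (\<Sum>i<n. q (w i) (w (Suc i))) + (\<Sum>i<m. q (w (n + i)) (w (Suc (n + i))))"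
      unfolding len_def .
    also have "(\<Sum>i<n. q (w i) (w (Suc i))) = a"
      unfolding u(1) len_def w_def using u v
    proof (intro sum.cong refl)
      \<comment> \<open>At the joint \<open>Suc i = n\<close> the second sequence has already taken
        over; \<open>u n = y = v 0\<close> makes the terms agree.\<close>
      show "q (if i < n then u i else v (i - n)) (if Suc i < n then u (Suc i) else v (Suc i - n)) =
          q (u i) (u (Suc i))" if "i \<in> {..<n}" for i
        using that u v by (cases "Suc i = n") auto
    qed
    also have "(\<Sum>i<m. q (w (n + i)) (w (Suc (n + i)))) = b"
      unfolding v(1) len_def w_def by (auto simp: Suc_diff_le)
    finally have "len w (n + m) = a + b" .
    moreover have "w 0 = x" "w (n + m) = z" "\<And>i. w i \<in> S" using u v by (auto simp: w_def)
    ultimately show ?thesis using lenC[of w "n + m"] by simp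
  qed
  have "Metric_space S d"
  proof
    show "0 \<le> d x y" for x y
      using lower[of x y] nn[of x y] by (cases "x \<in> S \<and> y \<in> S") (auto simp: d_def)
    show "d x y = d y x" for x y unfolding d_def using C_sym by auto
    show "d x y = 0 \<longleftrightarrow> x = y" if "x \<in> S" "y \<in> S" for x y
      using lower[OF that] upper[OF that] zero[OF that] nn[OF that] by fastforce
    show "d x z \<le> d x y + d y z" if "x \<in> S" "y \<in> S" "z \<in> S" for x y z
    proof -
      have "Inf (C x z) - b \<le> Inf (C x y)" if b: "b \<in> C y z" for b
      proof (rule cInf_greatest)
        show "C x y \<noteq> {}" using C_q \<open>x \<in> S\<close> \<open>y \<in> S\<close> by blast
        fix a assume "a \<in> C x y"
        then have "Inf (C x z) \<le> a + b" using C_add b bdd by (intro cInf_lower)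
        then show "Inf (C x z) - b \<le> a" by simp
      qed
      then have "Inf (C x z) - Inf (C x y) \<le> Inf (C y z)"
        using C_q \<open>y \<in> S\<close> \<open>z \<in> S\<close> by (intro cInf_greatest) (auto simp: algebra_simps)
      with that show ?thesis by (simp add: d_def)
    qed
  qed
  with upper lower that show thesis by blast
qed

section \<open>Ancestors, children and rays in the reference tree\<close>

section \<open>The rooted tree\<close>

locale rooted_tree =
  fixes T :: "'t set" and A :: "'t \<Rightarrow> 't \<Rightarrow> nat" and \<phi> :: 't
  assumes ref_tree: "reference_tree T A \<phi>"
begin

abbreviation par :: "'t \<Rightarrow> 't" where "par \<equiv> parent T A \<phi>"

definition rpath :: "'t \<Rightarrow> 't list" where
  "rpath w = (THE p. path_between T (adj A) \<phi> w p \<and> distinct p)"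

definition depth :: "'t \<Rightarrow> nat" where
  "depth w = graph_dist T (adj A) \<phi> w"

lemma root_in: "\<phi> \<in> T"
  and adj_sym: "\<lbrakk>w \<in> T; v \<in> T; A w v = 1\<rbrakk> \<Longrightarrow> A v w = 1"
  and adj_irrefl: "w \<in> T \<Longrightarrow> A w w \<noteq> 1"
  and finite_adj: "w \<in> T \<Longrightarrow> finite {v \<in> T. A w v = 1}"
  using ref_tree by (auto simp: reference_tree_def locally_finite_graph_def)

lemma rpath_ex1: "w \<in> T \<Longrightarrow> \<exists>!p. path_between T (adj A) \<phi> w p \<and> distinct p"
  using ref_tree by (auto simp: reference_tree_def is_tree_def)

lemma rpath:
  assumes "w \<in> T"
  shows "path_between T (adj A) \<phi> w (rpath w)" "distinct (rpath w)"
  using theI'[OF rpath_ex1[OF assms]] unfolding rpath_def by auto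

lemma rpath_unique: "\<lbrakk>w \<in> T; path_between T (adj A) \<phi> w p; distinct p\<rbrakk> \<Longrightarrow> p = rpath w"
  using rpath_ex1 rpath by metis

lemma rpath_root: "rpath \<phi> = [\<phi>]"
  using rpath_unique[of \<phi> "[\<phi>]"] root_in by (simp add: path_between_def)

lemma rpath_last: "w \<in> T \<Longrightarrow> last (rpath w) = w" and rpath_not_Nil: "w \<in> T \<Longrightarrow> rpath w \<noteq> []"
  and rpath_subset: "w \<in> T \<Longrightarrow> set (rpath w) \<subseteq> T" and rpath_hd: "w \<in> T \<Longrightarrow> hd (rpath w) = \<phi>"
  using rpath by (auto simp: path_between_def)

text \<open>The tree axiom speaks of self-avoiding paths, \<open>parent\<close> and
  \<open>subtree\<close> of geodesics. Geodesics are self-avoiding, so uniqueness identifies the two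
  notions.\<close>

lemma is_geodesic_root_iff:
  assumes "w \<in> T"
  shows "is_geodesic T (adj A) \<phi> w p \<longleftrightarrow> p = rpath w"
proof -
  have *: "p = rpath w" if "is_geodesic T (adj A) \<phi> w p" for p
    using that rpath_unique[OF assms] distinct_geodesic[OF that] by (auto simp: is_geodesic_def)
  with is_geodesic_exists[OF rpath(1)[OF assms]] show ?thesis by metis
qed

lemma length_rpath: "w \<in> T \<Longrightarrow> length (rpath w) = Suc (depth w)"
  using is_geodesic_root_iff[of w "rpath w"] by (simp add: is_geodesic_def depth_def)

lemma rpath_snoc:
  assumes "w \<in> T" "v \<in> T" "A w v = 1" "v \<notin> set (rpath w)"
  shows "rpath v = rpath w @ [v]"
proof -
  have "path_between T (adj A) \<phi> v (rpath w @ [v])"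
    using assms rpath rpath_last rpath_not_Nil by (subst path_between_snoc) auto
  then show ?thesis using rpath_unique[of v "rpath w @ [v]"] assms rpath by auto
qed

lemma parent_root [simp]: "par \<phi> = \<phi>"
  by (simp add: parent_def)

text \<open>Dropping \<open>w\<close> from its root path leaves the root path of its predecessor
  \<open>u\<close>. An earlier vertex \<open>v\<close> of the path adjacent to \<open>w\<close>
  would give a second self-avoiding path through the shortcut from \<open>v\<close> to
  \<open>w\<close>; hence the \<open>THE\<close> in \<open>parent\<close> denotes
  \<open>u\<close>.\<close>

lemma rpath_parent:
  assumes "w \<in> T" "w \<noteq> \<phi>"
  shows "par w \<in> T" "A (par w) w = 1" "rpath w = rpath (par w) @ [w]"
    and "\<And>v. \<lbrakk>v \<in> set (rpath w); A w v = 1\<rbrakk> \<Longrightarrow> v = par w"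
proof -
  obtain q where q: "rpath w = q @ [w]"
    using rpath_not_Nil[OF assms(1)] rpath_last[OF assms(1)] by (metis append_butlast_last_id)
  have "q \<noteq> []"
  proof
    assume "q = []"
    then show False using q rpath_hd[OF assms(1)] assms(2) by simp
  qed
  define u where "u = last q"
  have pq: "path_between T (adj A) \<phi> u q" "A u w = 1"
    using rpath(1)[OF assms(1)] path_between_snoc[OF \<open>q \<noteq> []\<close>, of T "adj A" \<phi> w] unfolding q u_def by auto
  have dq: "distinct q" "w \<notin> set q" using rpath(2)[OF assms(1)] q by auto
  have uT: "u \<in> T" using pq(1) \<open>q \<noteq> []\<close> by (auto simp: path_between_def u_def)
  have rq: "q = rpath u" using rpath_unique[OF uT pq(1) dq(1)] .
  have uniq: "v = u" if "v \<in> set (rpath w)" "A w v = 1" for v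
  proof -
    have "v \<noteq> w" using that adj_irrefl[OF assms(1)] by auto
    with that q obtain q1 q2 where q12: "q = q1 @ v # q2" by (auto simp: in_set_conv_decomp)
    have vT: "v \<in> T" using rpath_subset[OF assms(1)] that by auto
    have "path_between T (adj A) \<phi> v (q1 @ [v])"
      using pq(1) unfolding q12 by (auto simp: path_between_def successively_append_iff hd_append)
    then have "rpath v = q1 @ [v]" using rpath_unique[OF vT, of "q1 @ [v]"] dq(1) q12 by auto
    moreover have "w \<notin> set (q1 @ [v])" using dq(2) q12 by auto
    ultimately have "rpath w = q1 @ [v] @ [w]"
      using rpath_snoc[OF vT assms(1) adj_sym[OF assms(1) vT that(2)]] by simp
    then have "q = q1 @ [v]" using q by simp
    then show ?thesis by (simp add: u_def)
  qed
  have "par w = u"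
    using assms(2) adj_sym[OF uT assms(1) pq(2)] q \<open>q \<noteq> []\<close> uniq
    unfolding parent_def is_geodesic_root_iff[OF assms(1)]
    by (auto intro!: the_equality simp: u_def)
  then show "par w \<in> T" "A (par w) w = 1" "rpath w = rpath (par w) @ [w]"
    "\<And>v. \<lbrakk>v \<in> set (rpath w); A w v = 1\<rbrakk> \<Longrightarrow> v = par w"
    using uT pq(2) q rq uniq by auto
qed

lemma parent_in: "w \<in> T \<Longrightarrow> par w \<in> T"
  using rpath_parent(1) root_in by (cases "w = \<phi>") auto

lemma parent_pow_in: "w \<in> T \<Longrightarrow> (par ^^ i) w \<in> T"
  by (induction i) (auto intro: parent_in)

lemma parent_pow_root: "(par ^^ i) \<phi> = \<phi>"
  by (induction i) auto

lemma depth_root [simp]: "depth \<phi> = 0"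
  using length_rpath[OF root_in] rpath_root by simp

lemma depth_parent: "\<lbrakk>w \<in> T; w \<noteq> \<phi>\<rbrakk> \<Longrightarrow> depth w = Suc (depth (par w))"
  using length_rpath[of w] length_rpath[OF parent_in, of w] rpath_parent(3)[of w] by simp

lemma depth_eq_0: "w \<in> T \<Longrightarrow> depth w = 0 \<longleftrightarrow> w = \<phi>"
  using depth_parent[of w] by (cases "w = \<phi>") auto

lemma parent_pow_depth: "w \<in> T \<Longrightarrow> (par ^^ depth w) w = \<phi>"
proof (induction "depth w" arbitrary: w)
  case 0
  then show ?case by (simp add: depth_eq_0)
next
  case (Suc n)
  then have "w \<noteq> \<phi>" by auto
  then have "depth w = Suc (depth (par w))" using depth_parent Suc by simp
  with Suc show ?case by (simp add: parent_in funpow_swap1)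
qed

text \<open>Ancestors become iterates of \<open>par\<close>. Since
  \<open>par \<phi> = \<phi>\<close>, iterates past the depth stay at the root, so the exponent may
  range over all naturals.\<close>

lemma set_rpath: "w \<in> T \<Longrightarrow> set (rpath w) = range (\<lambda>i. (par ^^ i) w)"
proof (induction "depth w" arbitrary: w)
  case 0
  then show ?case by (auto simp: depth_eq_0 rpath_root parent_pow_root)
next
  case (Suc n)
  then have "w \<noteq> \<phi>" by auto
  then have "set (rpath w) = insert w (range (\<lambda>i. (par ^^ i) (par w)))"
    using Suc depth_parent[of w] by (simp add: parent_in rpath_parent(3))
  also have "\<dots> = range (\<lambda>i. (par ^^ i) w)"
  proof (intro equalityI subsetI)
    fix x assume "x \<in> insert w (range (\<lambda>i. (par ^^ i) (par w)))"
    then consider "x = (par ^^ 0) w" | i where "x = (par ^^ Suc i) w"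
      by (auto simp: funpow_swap1)
    then show "x \<in> range (\<lambda>i. (par ^^ i) w)" by cases blast+
  next
    fix x assume "x \<in> range (\<lambda>i. (par ^^ i) w)"
    then obtain i where "x = (par ^^ i) w" by blast
    then show "x \<in> insert w (range (\<lambda>i. (par ^^ i) (par w)))"
      by (cases i) (auto simp: funpow_swap1)
  qed
  finally show ?case .
qed

lemma subtree_iff: "w \<in> subtree T A \<phi> v \<longleftrightarrow> w \<in> T \<and> (\<exists>i. v = (par ^^ i) w)"
  by (auto simp: subtree_def is_geodesic_root_iff set_rpath simp del: One_nat_def)

text \<open>A neighbour other than the parent lies off the root path of \<open>w\<close>, so
  appending it yields its own root path. The clause \<open>v \<noteq> \<phi>\<close> keeps the root,
  which is its own \<open>par\<close>, from being its own child.\<close>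

lemma children_iff:
  assumes "w \<in> T"
  shows "v \<in> children T A \<phi> w \<longleftrightarrow> v \<in> T \<and> v \<noteq> \<phi> \<and> par v = w"
proof
  assume v: "v \<in> children T A \<phi> w"
  then have vT: "v \<in> T" "A w v = 1" "v \<noteq> par w" by (auto simp: children_def)
  have "v \<notin> set (rpath w)"
  proof
    assume "v \<in> set (rpath w)"
    then show False
      using rpath_parent(4)[OF assms] vT adj_irrefl[OF root_in] by (cases "w = \<phi>") (auto simp: rpath_root)
  qed
  then have r: "rpath v = rpath w @ [v]" using rpath_snoc[OF assms vT(1,2)] by simp
  then have "v \<noteq> \<phi>" using rpath_root rpath_not_Nil[OF assms] by auto
  moreover from this have "rpath (par v) = rpath w" using rpath_parent(3)[OF vT(1)] r by simp
  then have "par v = w" using rpath_last assms parent_in[OF vT(1)] by metis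
  ultimately show "v \<in> T \<and> v \<noteq> \<phi> \<and> par v = w" using vT by simp
next
  assume v: "v \<in> T \<and> v \<noteq> \<phi> \<and> par v = w"
  then have "depth v = Suc (depth w)" using depth_parent by blast
  moreover have "depth (par w) \<le> depth w" using depth_parent[OF assms] by (cases "w = \<phi>") auto
  ultimately have "v \<noteq> par w" by auto
  then show "v \<in> children T A \<phi> w" using v rpath_parent(2)[of v] by (auto simp: children_def)
qed

lemma finite_children: "w \<in> T \<Longrightarrow> finite (children T A \<phi> w)"
  using finite_adj[of w] by (auto simp: children_def elim: rev_finite_subset)

lemma finite_depth: "finite {w \<in> T. depth w = m}"
proof (induction m)
  case 0
  have "{w \<in> T. depth w = 0} \<subseteq> {\<phi>}" by (auto simp: depth_eq_0)
  then show ?case using finite_subset by blast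
next
  case (Suc m)
  have "{w \<in> T. depth w = Suc m} \<subseteq> (\<Union>u\<in>{w \<in> T. depth w = m}. children T A \<phi> u)"
  proof
    fix w assume w: "w \<in> {w \<in> T. depth w = Suc m}"
    then have "w \<noteq> \<phi>" by auto
    with w show "w \<in> (\<Union>u\<in>{w \<in> T. depth w = m}. children T A \<phi> u)"
      using depth_parent[of w] parent_in[of w] by (auto simp: children_iff)
  qed
  then show ?case by (rule finite_subset) (use Suc finite_children in auto)
qed

lemma finite_depth_le: "finite {w \<in> T. depth w \<le> m}"
proof -
  have "{w \<in> T. depth w \<le> m} = (\<Union>i\<in>{..m}. {w \<in> T. depth w = i})" by auto
  then show ?thesis using finite_depth by simp
qed

lemma descending_geodesic_ray:
  assumes "\<omega> 0 = \<phi>" "\<And>n. \<omega> (Suc n) \<in> children T A \<phi> (\<omega> n)"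
  shows "\<omega> \<in> geodesic_rays T (adj A) \<phi>"
proof -
  have T: "\<omega> n \<in> T" for n using assms root_in by (cases n) (auto simp: children_def)
  have "depth (\<omega> n) = n" for n
  proof (induction n)
    case (Suc n)
    then show ?case using assms(2)[of n] children_iff[OF T] depth_parent by fastforce
  qed (simp add: assms)
  moreover have "depth b \<le> Suc (depth a)" if "a \<in> T" "b \<in> T" "A a b = 1" for a b
    using that rpath_snoc[of a b] length_rpath children_iff[of a b] depth_parent[of b] depth_parent[of a]
    by (cases "b = par a"; cases "a = \<phi>") (auto simp: children_def)
  ultimately show ?thesis
    using T assms by (intro geodesic_raysI[where f = depth]) (auto simp: children_def)
qed

text \<open>Koenig's lemma: a vertex with infinitely many descendants in \<open>P\<close> has such a
  child, as it has finitely many children. By \<open>closed\<close>, a vertex with a descendant in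
  \<open>P\<close> is itself in \<open>P\<close>, so the ray stays in \<open>P\<close>.\<close>

lemma koenig_ray:
  assumes closed: "\<And>w. \<lbrakk>w \<in> T; P w\<rbrakk> \<Longrightarrow> P (par w)"
    and deep: "\<And>m. \<exists>w\<in>T. depth w \<ge> m \<and> P w"
  obtains \<omega> where "\<omega> \<in> geodesic_rays T (adj A) \<phi>" "\<And>n. P (\<omega> n)" "\<And>n. \<omega> (Suc n) \<in> children T A \<phi> (\<omega> n)"
proof -
  define below where "below v = {w \<in> T. P w \<and> (\<exists>i. v = (par ^^ i) w)}" for v
  define good where "good v \<longleftrightarrow> v \<in> T \<and> infinite (below v)" for v
  have closed_pow: "P ((par ^^ i) w)" if "w \<in> T" "P w" for i w
    using that by (induction i) (auto intro: closed parent_pow_in)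
  have below_root: "below \<phi> = {w \<in> T. P w}"
    using parent_pow_depth unfolding below_def by (metis (lifting))
  have "infinite {w \<in> T. P w}"
  proof
    assume f: "finite {w \<in> T. P w}"
    obtain w where w: "w \<in> T" "P w" "depth w \<ge> Suc (Max (depth ` {w \<in> T. P w}))" using deep by blast
    then have "depth w \<le> Max (depth ` {w \<in> T. P w})" using f by (intro Max_ge) auto
    with w show False by simp
  qed
  then have good_root: "good \<phi>" using root_in below_root by (simp add: good_def)
  have good_P: "P v" if "good v" for v
  proof -
    from that have "below v \<noteq> {}" by (auto simp: good_def)
    then show ?thesis using closed_pow by (auto simp: below_def)
  qed
  have step: "\<exists>u. u \<in> children T A \<phi> v \<and> good u" if v: "good v" for v
  proof (rule ccontr)
    assume no: "\<not> ?thesis"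
    have vT: "v \<in> T" using v by (simp add: good_def)
    have "below v \<subseteq> insert v (\<Union>u\<in>children T A \<phi> v. below u)"
    proof
      fix w assume "w \<in> below v"
      then obtain i where w: "w \<in> T" "P w" and "v = (par ^^ i) w" by (auto simp: below_def)
      then have ex: "\<exists>i. v = (par ^^ i) w" by blast
      \<comment> \<open>Minimality matters at the root: with a larger exponent, the vertex one step
        before \<open>v\<close> could be \<open>\<phi>\<close> again and not a child of
        \<open>v\<close>.\<close>
      define j where "j = (LEAST i. v = (par ^^ i) w)"
      have j: "v = (par ^^ j) w" using LeastI_ex[OF ex] by (simp add: j_def)
      show "w \<in> insert v (\<Union>u\<in>children T A \<phi> v. below u)"
      proof (cases j)
        case 0
        then show ?thesis using j by simp
      next
        case (Suc k)
        then have "v \<noteq> (par ^^ k) w" using not_less_Least[of k "\<lambda>i. v = (par ^^ i) w"] by (simp add: j_def)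
        then have "(par ^^ k) w \<noteq> \<phi>" using j Suc by auto
        then have "(par ^^ k) w \<in> children T A \<phi> v" "w \<in> below ((par ^^ k) w)"
          using j Suc w parent_pow_in vT by (auto simp: children_iff below_def)
        then show ?thesis by blast
      qed
    qed
    moreover have "finite (below u)" if "u \<in> children T A \<phi> v" for u
      using no that by (auto simp: good_def children_def)
    ultimately have "finite (below v)" using finite_children[OF vT] by (meson finite_UN_I finite_insert finite_subset)
    then show False using v by (simp add: good_def)
  qed
  define next_v where "next_v v = (SOME u. u \<in> children T A \<phi> v \<and> good u)" for v
  have next_v: "next_v v \<in> children T A \<phi> v" "good (next_v v)" if "good v" for v
    using someI_ex[OF step[OF that]] by (auto simp: next_v_def)
  define \<omega> where "\<omega> n = (next_v ^^ n) \<phi>" for n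
  have good_\<omega>: "good (\<omega> n)" for n
    by (induction n) (auto simp: \<omega>_def good_root next_v)
  then have "\<omega> (Suc n) \<in> children T A \<phi> (\<omega> n)" for n using next_v by (simp add: \<omega>_def)
  moreover have "\<omega> 0 = \<phi>" by (simp add: \<omega>_def)
  ultimately show thesis using that descending_geodesic_ray good_\<omega> good_P by blast
qed

end

section \<open>Ancestors in a scale, chains of cells and smallness of cells\<close>

section \<open>Scales of a weighted partition\<close>

locale weighted_partition = rooted_tree T A \<phi>
  for T :: "'t set" and A :: "'t \<Rightarrow> 't \<Rightarrow> nat" and \<phi> :: 't +
  fixes X :: "'x topology" and K :: "'t \<Rightarrow> 'x set" and g :: "'t \<Rightarrow> real"
  assumes compact_X: "compact_space X" and metrizable_X: "metrizable_space X"
    and partition: "partition_of X T A \<phi> K"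
    and weight: "g \<in> weight_functions T A \<phi>"
begin

abbreviation S :: "'x set" where "S \<equiv> topspace X"

abbreviation \<Lambda> :: "real \<Rightarrow> 't set" where "\<Lambda> s \<equiv> scale T A \<phi> g s"

lemma K_not_empty: "w \<in> T \<Longrightarrow> K w \<noteq> {}"
  and K_compact: "w \<in> T \<Longrightarrow> compactin X (K w)"
  and K_root: "K \<phi> = S"
  and K_children: "w \<in> T \<Longrightarrow> K w = (\<Union>v\<in>children T A \<phi> w. K v)"
  and K_ray: "\<omega> \<in> geodesic_rays T (adj A) \<phi> \<Longrightarrow> \<exists>x. (\<Inter>m. K (\<omega> m)) = {x}"
  using partition by (auto simp: partition_of_def simp del: One_nat_def)

lemma K_subset: "w \<in> T \<Longrightarrow> K w \<subseteq> S"
  using K_compact compactin_subset_topspace by blast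

lemma K_closed: "w \<in> T \<Longrightarrow> closedin X (K w)"
  using K_compact metrizable_X by (blast intro: compactin_imp_closedin metrizable_imp_Hausdorff_space)

lemma g_pos: "w \<in> T \<Longrightarrow> 0 < g w" and g_le_1: "w \<in> T \<Longrightarrow> g w \<le> 1" and g_root: "g \<phi> = 1"
  and g_parent: "w \<in> T \<Longrightarrow> g w \<le> g (par w)"
  using weight by (auto simp: weight_functions_def)

lemma g_small:
  assumes "0 < s"
  obtains m where "\<And>w. \<lbrakk>w \<in> T; m \<le> depth w\<rbrakk> \<Longrightarrow> g w < s"
proof -
  have "(\<lambda>m. SUP w\<in>level T A \<phi> m. g w) \<longlonglongrightarrow> 0" using weight by (auto simp: weight_functions_def)
  then obtain m where m: "\<And>n. n \<ge> m \<Longrightarrow> norm ((SUP w\<in>level T A \<phi> n. g w) - 0) < s"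
    using assms by (meson LIMSEQ_iff)
  have "g w < s" if w: "w \<in> T" "m \<le> depth w" for w
  proof -
    have "g w \<le> (SUP w\<in>level T A \<phi> (depth w). g w)"
      by (rule cSUP_upper) (use w g_le_1 in \<open>auto simp: level_def depth_def intro!: bdd_aboveI[of _ 1]\<close>)
    with m[OF w(2)] show ?thesis by simp
  qed
  with that show thesis by blast
qed

lemma K_parent: "w \<in> T \<Longrightarrow> K w \<subseteq> K (par w)"
  using K_children[OF parent_in, of w] by (cases "w = \<phi>") (auto simp: children_iff parent_in)

lemma K_parent_pow: "w \<in> T \<Longrightarrow> K w \<subseteq> K ((par ^^ i) w)"
  by (induction i) (use K_parent parent_pow_in in auto)

lemma g_parent_pow: "w \<in> T \<Longrightarrow> g w \<le> g ((par ^^ i) w)"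
  by (induction i) (use g_parent parent_pow_in in \<open>auto intro: order_trans\<close>)

text \<open>Each point of a cell lies in the cell of some child, and this is iterated. The bound on
  the depth is recorded because \<open>w = (par ^^ n) v\<close> alone would allow
  \<open>v = w = \<phi>\<close>.\<close>

lemma K_descendant:
  assumes "w \<in> T" "x \<in> K w"
  shows "\<exists>v\<in>T. w = (par ^^ n) v \<and> x \<in> K v \<and> n \<le> depth v"
proof (induction n)
  case 0
  then show ?case using assms by auto
next
  case (Suc n)
  then obtain v where v: "v \<in> T" "w = (par ^^ n) v" "x \<in> K v" "n \<le> depth v" by blast
  then obtain u where u: "u \<in> children T A \<phi> v" "x \<in> K u" using K_children[OF v(1)] by blast
  then have "u \<in> T" "u \<noteq> \<phi>" "par u = v" using children_iff[OF v(1)] by auto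
  then have "w = (par ^^ Suc n) u" "Suc n \<le> depth u"
    using v depth_parent[of u] by (auto simp: funpow_swap1)
  then show ?case using u \<open>u \<in> T\<close> by blast
qed

lemma scale_in: "w \<in> \<Lambda> s \<Longrightarrow> w \<in> T" and scale_le: "w \<in> \<Lambda> s \<Longrightarrow> g w \<le> s"
  using root_in g_root by (auto simp: scale_def split: if_splits)

lemma scale_ge_1: "1 \<le> s \<Longrightarrow> \<Lambda> s = {\<phi>}"
  by (simp add: scale_def)

text \<open>For \<open>s < 1\<close> the parent of an element of \<open>\<Lambda> s\<close> has
  weight above \<open>s\<close>, which fails at great depth; only finitely many vertices have
  bounded depth.\<close>

lemma scale_finite: "0 < s \<Longrightarrow> finite (\<Lambda> s)"
proof (cases "s \<ge> 1")
  case False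
  assume "0 < s"
  then obtain m where m: "\<And>w. \<lbrakk>w \<in> T; m \<le> depth w\<rbrakk> \<Longrightarrow> g w < s" using g_small by blast
  have "depth w \<le> m" if w: "w \<in> \<Lambda> s" for w
  proof -
    have "w \<in> T" "g (par w) > s" using w False by (auto simp: scale_def)
    then show ?thesis using m[OF parent_in, of w] depth_parent[of w] by (cases "w = \<phi>") fastforce+
  qed
  then have "\<Lambda> s \<subseteq> {w \<in> T. depth w \<le> m}" using scale_in by blast
  then show ?thesis using finite_depth_le finite_subset by blast
qed (simp add: scale_ge_1)

text \<open>The ancestor of \<open>w\<close> in the scale \<open>\<Lambda> s\<close>; it exists as soon as \<open>g w \<le> s\<close>.\<close>

definition up :: "real \<Rightarrow> 't \<Rightarrow> 't" where
  "up s w = (if s \<ge> 1 then \<phi> else (par ^^ (LEAST i. g ((par ^^ Suc i) w) > s)) w)"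

lemma up_ancestor:
  assumes "w \<in> T"
  obtains i where "up s w = (par ^^ i) w"
proof (cases "s \<ge> 1")
  case True
  then show thesis using that[of "depth w"] parent_pow_depth[OF assms] by (simp add: up_def)
next
  case False
  then show thesis by (intro that) (simp add: up_def)
qed

text \<open>The search in \<open>up\<close> succeeds at index \<open>depth w\<close> at the latest,
  since the root has weight \<open>1 > s\<close>. Minimality of the index then bounds the weight of
  the vertex found by \<open>s\<close>.\<close>

lemma up_in:
  assumes "w \<in> T" "g w \<le> s"
  shows "up s w \<in> \<Lambda> s"
proof (cases "s \<ge> 1")
  case True
  then show ?thesis by (simp add: up_def scale_ge_1)
next
  case False
  define P where "P i \<longleftrightarrow> g ((par ^^ Suc i) w) > s" for i
  define i where "i = (LEAST i. P i)"
  have "P (depth w)" unfolding P_def using False parent_pow_depth[OF assms(1)] by (simp add: g_root)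
  then have "P i" unfolding i_def by (rule LeastI)
  have "g ((par ^^ i) w) \<le> s"
  proof (cases i)
    case (Suc j)
    then have "\<not> P j" using not_less_Least[of j P] by (simp add: i_def)
    then show ?thesis using Suc by (simp add: P_def)
  qed (use assms in simp)
  moreover have "up s w = (par ^^ i) w" using False by (simp add: up_def i_def P_def)
  ultimately show ?thesis using False \<open>P i\<close> parent_pow_in[OF assms(1)] by (simp add: scale_def P_def)
qed

text \<open>Weights never decrease towards the root, so the line of ancestors crosses the threshold
  \<open>s\<close> once and meets \<open>\<Lambda> s\<close> in at most one vertex.\<close>

lemma up_unique:
  assumes "w \<in> T" "v \<in> \<Lambda> s" "v = (par ^^ i) w"
  shows "up s w = v"
proof (cases "s \<ge> 1")
  case True
  then show ?thesis using assms by (simp add: up_def scale_ge_1)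
next
  case False
  have v: "g (par v) > s" "g v \<le> s" using assms(2) False by (auto simp: scale_def)
  have "(LEAST i. g ((par ^^ Suc i) w) > s) = i"
  proof (rule Least_equality)
    show "g ((par ^^ Suc i) w) > s" using v assms(3) by simp
    fix j assume j: "g ((par ^^ Suc j) w) > s"
    show "i \<le> j"
    proof (rule ccontr)
      assume "\<not> i \<le> j"
      then have "i = (i - Suc j) + Suc j" by simp
      then have "v = (par ^^ (i - Suc j)) ((par ^^ Suc j) w)"
        unfolding assms(3) by (metis comp_apply funpow_add)
      then have "g ((par ^^ Suc j) w) \<le> g v" using g_parent_pow parent_pow_in[OF assms(1)] by metis
      with j v show False by simp
    qed
  qed
  then show ?thesis using False assms(3) by (simp add: up_def)
qed

lemma up_self: "w \<in> \<Lambda> s \<Longrightarrow> up s w = w"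
  using up_unique[of w w s 0] scale_in by simp

lemma K_up: "w \<in> T \<Longrightarrow> K w \<subseteq> K (up s w)"
  using up_ancestor K_parent_pow by metis

lemma up_scale: "\<lbrakk>w \<in> \<Lambda> s; s \<le> t\<rbrakk> \<Longrightarrow> up t w \<in> \<Lambda> t"
  using up_in[of w t] scale_in scale_le by fastforce

lemma up_up:
  assumes "w \<in> T" "g w \<le> s" "s \<le> t"
  shows "up t (up s w) = up t w"
proof -
  obtain i where i: "up s w = (par ^^ i) w" using up_ancestor[OF assms(1)] .
  have "up s w \<in> \<Lambda> s" using up_in assms by simp
  then have u: "up s w \<in> T" "up t (up s w) \<in> \<Lambda> t" using scale_in up_scale assms by auto
  obtain j where "up t (up s w) = (par ^^ j) (up s w)" using up_ancestor[OF u(1)] .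
  then have "up t (up s w) = (par ^^ (j + i)) w" using i by (simp add: funpow_add)
  then show ?thesis using up_unique[OF assms(1) u(2)] by simp
qed

text \<open>Descend through cells containing \<open>x\<close> until the weight is below
  \<open>t\<close>, then climb back to \<open>\<Lambda> t\<close>; uniqueness of the ancestor in
  \<open>\<Lambda> s\<close> leads back to \<open>w\<close>.\<close>

lemma K_down:
  assumes "w \<in> \<Lambda> s" "0 < t" "t \<le> s" "x \<in> K w"
  obtains v where "v \<in> \<Lambda> t" "x \<in> K v" "up s v = w"
proof -
  obtain m where m: "\<And>w. \<lbrakk>w \<in> T; m \<le> depth w\<rbrakk> \<Longrightarrow> g w < t" using g_small[OF assms(2)] by blast
  obtain v where v: "v \<in> T" "w = (par ^^ m) v" "x \<in> K v" "m \<le> depth v"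
    using K_descendant[OF scale_in[OF assms(1)] assms(4)] by blast
  then have gv: "g v \<le> t" using m by fastforce
  have "up s (up t v) = w" using up_up[OF v(1) gv assms(3)] up_unique[OF v(1) assms(1) v(2)] by simp
  with that[of "up t v"] show thesis using up_in[OF v(1) gv] K_up[OF v(1)] v(3) by blast
qed

lemma scale_cover:
  assumes "x \<in> S" "0 < s"
  obtains w where "w \<in> \<Lambda> s" "x \<in> K w"
proof (cases "s \<ge> 1")
  case True
  with that assms show thesis by (simp add: scale_ge_1 K_root)
next
  case False
  with that assms show thesis using K_down[of \<phi> 1 s x] by (auto simp: scale_ge_1 K_root)
qed

subsection \<open>Chains of cells\<close>

text \<open>A power \<open>meet s ^^ n\<close> is a chain of \<open>n\<close> links between
  \<open>n + 1\<close> cells. Reflexivity on \<open>\<Lambda> s\<close> allows chains to be padded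
  to any greater length.\<close>

definition meet :: "real \<Rightarrow> ('t \<times> 't) set" where
  "meet s = {(w, v). w \<in> \<Lambda> s \<and> v \<in> \<Lambda> s \<and> K w \<inter> K v \<noteq> {}}"

lemma meet_refl: "w \<in> \<Lambda> s \<Longrightarrow> (w, w) \<in> meet s"
  using K_not_empty scale_in by (auto simp: meet_def)

lemma meet_sym: "sym (meet s)"
  by (auto simp: meet_def sym_def)

lemma meet_relpow_in: "\<lbrakk>(w, v) \<in> meet s ^^ n; w \<in> \<Lambda> s\<rbrakk> \<Longrightarrow> v \<in> \<Lambda> s"
  by (cases n) (auto simp: meet_def)

lemma meet_relpow_refl: "w \<in> \<Lambda> s \<Longrightarrow> (w, w) \<in> meet s ^^ n"
  by (induction n) (auto intro: meet_refl)

lemma meet_relpow_mono: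
  assumes "(w, v) \<in> meet s ^^ m" "w \<in> \<Lambda> s" "m \<le> n"
  shows "(w, v) \<in> meet s ^^ n"
  using relpow_trans[OF assms(1) meet_relpow_refl, of "n - m"] meet_relpow_in[OF assms(1,2)] assms(3)
  by simp

lemma meet_up:
  assumes "(w, v) \<in> meet s" "s \<le> t"
  shows "(up t w, up t v) \<in> meet t"
proof -
  obtain x where wv: "w \<in> \<Lambda> s" "v \<in> \<Lambda> s" and "x \<in> K w" "x \<in> K v" using assms(1) by (auto simp: meet_def)
  then have "x \<in> K (up t w)" "x \<in> K (up t v)" using K_up scale_in by blast+
  then show ?thesis using up_scale[OF wv(1) assms(2)] up_scale[OF wv(2) assms(2)] by (auto simp: meet_def)
qed

lemma meet_relpow_up: "\<lbrakk>(w, v) \<in> meet s ^^ n; s \<le> t\<rbrakk> \<Longrightarrow> (up t w, up t v) \<in> meet t ^^ n"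
  by (induction n arbitrary: v) (auto intro: meet_up)

text \<open>The relational form of \<open>chain_nbhd\<close>, with \<open>n\<close> the number of
  links. Membership in \<open>\<Lambda> s\<close> is stated for \<open>w\<close> only; along the
  chain it passes to \<open>v\<close>.\<close>

definition near :: "real \<Rightarrow> nat \<Rightarrow> 'x \<Rightarrow> 'x \<Rightarrow> bool" where
  "near s n x y \<longleftrightarrow> (\<exists>w v. w \<in> \<Lambda> s \<and> x \<in> K w \<and> y \<in> K v \<and> (w, v) \<in> meet s ^^ n)"

lemma nearI: "\<lbrakk>w \<in> \<Lambda> s; x \<in> K w; y \<in> K v; (w, v) \<in> meet s ^^ n\<rbrakk> \<Longrightarrow> near s n x y"
  by (auto simp: near_def)

lemma near_in: "near s n x y \<Longrightarrow> x \<in> S \<and> y \<in> S"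
  unfolding near_def using K_subset scale_in meet_relpow_in by (meson subsetD)

lemma near_sym: "near s n x y \<Longrightarrow> near s n y x"
  unfolding near_def by (meson relpow_sym[OF meet_sym] meet_relpow_in)

lemma near_refl: "\<lbrakk>x \<in> S; 0 < s\<rbrakk> \<Longrightarrow> near s n x x"
  using scale_cover meet_relpow_refl by (metis near_def)

lemma near_mono: "\<lbrakk>near s m x y; m \<le> n\<rbrakk> \<Longrightarrow> near s n x y"
  unfolding near_def using meet_relpow_mono by blast

lemma near_up:
  assumes "near s n x y" "s \<le> t"
  shows "near t n x y"
proof -
  obtain w v where w: "w \<in> \<Lambda> s" "x \<in> K w" "y \<in> K v" "(w, v) \<in> meet s ^^ n"
    using assms(1) by (auto simp: near_def)
  then have "v \<in> \<Lambda> s" using meet_relpow_in by blast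
  with w show ?thesis
    using nearI[OF up_scale[OF w(1) assms(2)] _ _ meet_relpow_up[OF w(4) assms(2)]] K_up[OF scale_in] by blast
qed

text \<open>The two cells at \<open>y\<close> may differ but both contain \<open>y\<close>, so one
  more link joins the chains; hence the \<open>Suc\<close>.\<close>

lemma near_trans:
  assumes "near s m x y" "near s n y z"
  shows "near s (Suc (m + n)) x z"
proof -
  obtain w v where w: "w \<in> \<Lambda> s" "x \<in> K w" "y \<in> K v" "(w, v) \<in> meet s ^^ m"
    using assms(1) by (auto simp: near_def)
  obtain w' v' where w': "w' \<in> \<Lambda> s" "y \<in> K w'" "z \<in> K v'" "(w', v') \<in> meet s ^^ n"
    using assms(2) by (auto simp: near_def)
  have "v \<in> \<Lambda> s" using w meet_relpow_in by blast
  then have "(v, w') \<in> meet s" using w w' by (auto simp: meet_def)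
  then have "(w, v') \<in> meet s ^^ (Suc m + n)"
    using relpow_trans[OF relpow_Suc_I[OF w(4)] w'(4)] by blast
  then show ?thesis using nearI[OF w(1,2) w'(3)] by simp
qed

lemma near_ge_1: "\<lbrakk>x \<in> S; y \<in> S; 1 \<le> s\<rbrakk> \<Longrightarrow> near s n x y"
  using nearI[of \<phi> s x y \<phi> n] meet_relpow_refl[of \<phi> s] by (simp add: scale_ge_1 K_root)

text \<open>Only the numbering differs: cells run from \<open>1\<close> to \<open>M + 1\<close> in
  \<open>chain_nbhd\<close> and from \<open>0\<close> to \<open>M\<close> in the functional
  description of a relational power.\<close>

lemma chain_nbhd_iff: "y \<in> chain_nbhd X T A \<phi> K g M x s \<longleftrightarrow> near s M x y"
proof
  assume "y \<in> chain_nbhd X T A \<phi> K g M x s"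
  then obtain w where w: "\<forall>i\<in>{1..M+1}. w i \<in> \<Lambda> s" "x \<in> K (w 1)" "y \<in> K (w (M+1))"
    "\<forall>i\<in>{1..M}. K (w i) \<inter> K (w (i+1)) \<noteq> {}"
    by (auto simp: chain_nbhd_def)
  have "(w 1, w (M+1)) \<in> meet s ^^ M"
    unfolding relpow_fun_conv
    by (rule exI[of _ "\<lambda>i. w (i+1)"]) (use w in \<open>auto simp: meet_def\<close>)
  with w show "near s M x y" by (auto intro: nearI)
next
  assume n: "near s M x y"
  then obtain w v where w: "w \<in> \<Lambda> s" "x \<in> K w" "y \<in> K v" "(w, v) \<in> meet s ^^ M"
    by (auto simp: near_def)
  then obtain f where f: "f 0 = w" "f M = v" "\<And>i. i < M \<Longrightarrow> (f i, f (Suc i)) \<in> meet s"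
    by (auto simp: relpow_fun_conv)
  have "f i \<in> \<Lambda> s" if "i \<le> M" for i
    using f(1) f(3)[of "i - 1"] w(1) that by (cases i) (auto simp: meet_def)
  moreover have "K (f (i - 1)) \<inter> K (f i) \<noteq> {}" if "i \<in> {1..M}" for i
    using f(3)[of "i - 1"] that by (cases i) (auto simp: meet_def)
  ultimately show "y \<in> chain_nbhd X T A \<phi> K g M x s"
    using w f near_in[OF n] unfolding chain_nbhd_def
    by (auto intro!: exI[of _ "\<lambda>i. f (i - 1)"])
qed

subsection \<open>Cells become small\<close>

text \<open>The cells with two points at distance at least \<open>\<epsilon>\<close> are closed
  under parents. If they occurred at arbitrary depth, \<open>koenig_ray\<close> would give a ray of
  them, whereas by compactness the cells of a ray shrink into the ball of radius
  \<open>\<epsilon>/2\<close> about its point.\<close>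

lemma cells_small:
  assumes D: "Metric_space S D" "Metric_space.mtopology S D = X" and "0 < \<epsilon>"
  obtains t where "0 < t" "\<And>s w x y. \<lbrakk>s \<le> t; w \<in> \<Lambda> s; x \<in> K w; y \<in> K w\<rbrakk> \<Longrightarrow> D x y < \<epsilon>"
proof -
  interpret Metric_space S D by (rule D)
  define P where "P w \<longleftrightarrow> (\<exists>x\<in>K w. \<exists>y\<in>K w. \<epsilon> \<le> D x y)" for w
  have "\<exists>m. \<forall>w\<in>T. depth w \<ge> m \<longrightarrow> \<not> P w"
  proof (rule ccontr)
    assume "\<not> ?thesis"
    then have deep: "\<exists>w\<in>T. depth w \<ge> m \<and> P w" for m by blast
    have "P (par w)" if "w \<in> T" "P w" for w using that K_parent[of w] by (auto simp: P_def)
    then obtain \<omega> where \<omega>: "\<omega> \<in> geodesic_rays T (adj A) \<phi>" "\<And>n. P (\<omega> n)"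
      "\<And>n. \<omega> (Suc n) \<in> children T A \<phi> (\<omega> n)"
      using koenig_ray[of P] deep by blast
    have \<omega>T: "\<omega> n \<in> T" for n using geodesic_rays_step(2)[OF \<omega>(1)] .
    obtain p where p: "(\<Inter>m. K (\<omega> m)) = {p}" using K_ray[OF \<omega>(1)] by blast
    then have pS: "p \<in> S" using K_subset[OF \<omega>T] by blast
    \<comment> \<open>These are nested closed sets in a compact space. If all were nonempty, they
      would share a point of the intersection of the ray other than \<open>p\<close>.\<close>
    define C where "C n = K (\<omega> n) - mball p (\<epsilon>/2)" for n
    have "\<exists>n. C n = {}"
    proof (rule ccontr)
      assume "\<nexists>n. C n = {}"
      moreover have "closedin X (C n)" for n
        unfolding C_def using K_closed[OF \<omega>T] openin_mball[of p "\<epsilon>/2"] D(2) by (auto intro: closedin_diff)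
      moreover have "decseq C"
      proof (rule decseq_SucI)
        show "C (Suc n) \<subseteq> C n" for n
          using \<omega>(3)[of n] K_children[OF \<omega>T[of n]] by (auto simp: C_def simp del: in_mball)
      qed
      ultimately have "(\<Inter>n. C n) \<noteq> {}" using compact_space_imp_nest[OF compact_X, of C] by blast
      then obtain z where z: "\<And>n. z \<in> C n" by blast
      then have "z \<in> (\<Inter>m. K (\<omega> m))" by (auto simp: C_def)
      then have "z = p" using p by simp
      then show False using z[of 0] pS assms(3) by (simp add: C_def)
    qed
    then obtain n where n: "K (\<omega> n) \<subseteq> mball p (\<epsilon>/2)" by (auto simp: C_def)
    obtain x y where xy: "x \<in> K (\<omega> n)" "y \<in> K (\<omega> n)" "\<epsilon> \<le> D x y" using \<omega>(2)[of n] by (auto simp: P_def)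
    have "D x y \<le> D p x + D p y" using xy n by (intro triangle'') auto
    moreover have "D p x < \<epsilon>/2" "D p y < \<epsilon>/2" using xy n by auto
    ultimately show False using xy by simp
  qed
  then obtain m where m: "\<And>w. \<lbrakk>w \<in> T; m \<le> depth w\<rbrakk> \<Longrightarrow> \<not> P w" by blast
  \<comment> \<open>Scales below the least weight of the finitely many shallow vertices contain only
    deep ones. Half of that minimum makes the comparison strict.\<close>
  define F where "F = g ` {w \<in> T. depth w \<le> m}"
  have F: "finite F" "F \<noteq> {}" unfolding F_def using finite_depth_le root_in by (auto intro!: exI[of _ \<phi>])
  have "0 < Min F" using F g_pos by (auto simp: F_def)
  show thesis
  proof (rule that)
    show "0 < Min F / 2" using \<open>0 < Min F\<close> by simp
    fix s w x y assume s: "s \<le> Min F / 2" "w \<in> \<Lambda> s" "x \<in> K w" "y \<in> K w"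
    have "g w < Min F" using scale_le[OF s(2)] s(1) \<open>0 < Min F\<close> by linarith
    then have "\<not> depth w \<le> m" using F scale_in[OF s(2)] by (auto simp: F_def)
    then have "\<not> P w" using m scale_in[OF s(2)] by simp
    then show "D x y < \<epsilon>" using s(3,4) unfolding P_def by (meson not_less)
  qed
qed

lemma relpow_meet_dist:
  assumes D: "Metric_space S D"
    and cell: "\<And>w x y. \<lbrakk>w \<in> \<Lambda> s; x \<in> K w; y \<in> K w\<rbrakk> \<Longrightarrow> D x y \<le> \<epsilon>"
    and w: "(w, v) \<in> meet s ^^ n" "w \<in> \<Lambda> s" "x \<in> K w" "y \<in> K v"
  shows "D x y \<le> real (Suc n) * \<epsilon>"
  using w(1,4)
proof (induction n arbitrary: v y)
  case 0
  then show ?case using cell w by simp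
next
  case (Suc n)
  interpret Metric_space S D by (rule D)
  obtain u z where u: "(w, u) \<in> meet s ^^ n" "u \<in> \<Lambda> s" "v \<in> \<Lambda> s" "z \<in> K u" "z \<in> K v"
    using Suc.prems(1) by (auto simp: meet_def)
  have "D x y \<le> D x z + D z y" using Suc.prems w u K_subset scale_in by (intro triangle) blast+
  also have "\<dots> \<le> real (Suc n) * \<epsilon> + \<epsilon>"
    using Suc.IH[OF u(1,4)] cell[OF u(3,5) Suc.prems(2)] by simp
  finally show ?case by (simp add: algebra_simps)
qed

lemma near_small:
  assumes D: "Metric_space S D" "Metric_space.mtopology S D = X" and "0 < \<epsilon>"
  obtains t where "0 < t" "\<And>s x y. \<lbrakk>s \<le> t; near s n x y\<rbrakk> \<Longrightarrow> D x y < \<epsilon>"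
proof -
  obtain t where t: "0 < t"
    "\<And>s w x y. \<lbrakk>s \<le> t; w \<in> \<Lambda> s; x \<in> K w; y \<in> K w\<rbrakk> \<Longrightarrow> D x y < \<epsilon> / (2 * real (Suc n))"
    using cells_small[OF D, of "\<epsilon> / (2 * real (Suc n))"] assms(3)
    by (metis divide_pos_pos mult_pos_pos of_nat_0_less_iff zero_less_Suc zero_less_numeral)
  have "D x y < \<epsilon>" if s: "s \<le> t" and near: "near s n x y" for s x y
  proof -
    obtain w v where "w \<in> \<Lambda> s" "x \<in> K w" "y \<in> K v" "(w, v) \<in> meet s ^^ n"
      using near by (auto simp: near_def)
    then have "D x y \<le> real (Suc n) * (\<epsilon> / (2 * real (Suc n)))"
      using relpow_meet_dist[OF D(1)] t(2)[OF s] by (meson less_imp_le)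
    also have "\<dots> = \<epsilon> / 2" by (simp del: of_nat_Suc)
    finally show ?thesis using assms(3) by linarith
  qed
  with t that show thesis by blast
qed

lemma metric_exists:
  obtains D where "Metric_space S D" "Metric_space.mtopology S D = X"
  using metrizable_X Metric_space.topspace_mtopology by (metis metrizable_space_def)

lemma near_separates:
  assumes "x \<in> S" "y \<in> S" "x \<noteq> y"
  obtains t where "0 < t" "\<And>s. s \<le> t \<Longrightarrow> \<not> near s n x y"
proof -
  obtain D where D: "Metric_space S D" "Metric_space.mtopology S D = X" using metric_exists .
  interpret Metric_space S D by (rule D)
  have "0 < D x y" using assms by simp
  then obtain t where "0 < t" "\<And>s u v. \<lbrakk>s \<le> t; near s n u v\<rbrakk> \<Longrightarrow> D u v < D x y"
    using near_small[OF D] by metis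
  with that show thesis by blast
qed

text \<open>Remove the finitely many closed cells of \<open>\<Lambda> s\<close> that miss
  \<open>x\<close>. A cell containing a remaining point \<open>y\<close> then contains
  \<open>x\<close> as well, and the chain repeating this cell joins them.\<close>

lemma near_open_nbhd:
  assumes "x \<in> S" "0 < s"
  obtains U where "openin X U" "x \<in> U" "\<And>y. y \<in> U \<Longrightarrow> near s n x y"
proof
  let ?U = "S - \<Union>(K ` {w \<in> \<Lambda> s. x \<notin> K w})"
  show "openin X ?U"
    using scale_finite[OF assms(2)] K_closed scale_in by (auto intro!: openin_diff closedin_Union)
  show "x \<in> ?U" using assms by auto
  fix y assume y: "y \<in> ?U"
  then obtain w where w: "w \<in> \<Lambda> s" "y \<in> K w" using scale_cover assms by (metis DiffE)
  then have "x \<in> K w" using y by auto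
  then show "near s n x y" using w meet_relpow_refl nearI by blast
qed

end

section \<open>The Gromov product of the resolution in terms of chains\<close>

section \<open>The rearranged resolution\<close>

text \<open>Monotone convergence in two indices: once \<open>f n m\<close> exceeds \<open>a\<close>,
  all later values do, which is an event of the product filter.\<close>

lemma tendsto_SUP_incseq2:
  fixes f :: "nat \<Rightarrow> nat \<Rightarrow> 'a :: {complete_linorder, linorder_topology}"
  assumes "\<And>n m n' m'. \<lbrakk>n \<le> n'; m \<le> m'\<rbrakk> \<Longrightarrow> f n m \<le> f n' m'"
  shows "((\<lambda>(n, m). f n m) \<longlongrightarrow> (SUP p. f (fst p) (snd p))) (sequentially \<times>\<^sub>F sequentially)"
proof (rule order_tendstoI)
  fix a assume "a < (SUP p. f (fst p) (snd p))"
  then obtain n m where "a < f n m" by (auto simp: less_SUP_iff)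
  then have "\<And>n' m'. \<lbrakk>n \<le> n'; m \<le> m'\<rbrakk> \<Longrightarrow> a < f n' m'" using assms less_le_trans by metis
  then show "\<forall>\<^sub>F p in sequentially \<times>\<^sub>F sequentially. a < (case p of (n, m) \<Rightarrow> f n m)"
    unfolding eventually_prod_filter
    by (intro exI[of _ "\<lambda>i. n \<le> i"] exI[of _ "\<lambda>i. m \<le> i"]) (auto simp: eventually_sequentially)
next
  fix a assume a: "(SUP p. f (fst p) (snd p)) < a"
  have "f n m < a" for n m
    using SUP_upper[of "(n, m)" UNIV "\<lambda>p. f (fst p) (snd p)"] a by (simp add: le_less_trans)
  then show "\<forall>\<^sub>F p in sequentially \<times>\<^sub>F sequentially. (case p of (n, m) \<Rightarrow> f n m) < a"
    by (intro always_eventually) auto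
qed

locale weighted_resolution = weighted_partition T A \<phi> X K g
  for T :: "'t set" and A :: "'t \<Rightarrow> 't \<Rightarrow> nat" and \<phi> :: 't
    and X :: "'x topology" and K :: "'t \<Rightarrow> 'x set" and g :: "'t \<Rightarrow> real" +
  fixes r :: real
  assumes r_pos: "0 < r" and r_less: "r < 1"
begin

declare power_Suc [simp del]

abbreviation V :: "(nat \<times> 't) set" where "V \<equiv> resolution T A \<phi> g r"
abbreviation TE :: "nat \<times> 't \<Rightarrow> nat \<times> 't \<Rightarrow> bool" where "TE \<equiv> res_tree_edge T A \<phi> g r"
abbreviation E :: "nat \<times> 't \<Rightarrow> nat \<times> 't \<Rightarrow> bool" where "E \<equiv> res_edge T A \<phi> K g r"
abbreviation gp :: "nat \<times> 't \<Rightarrow> nat \<times> 't \<Rightarrow> real" where "gp \<equiv> gromov_product V E (0, \<phi>)"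
abbreviation anc :: "nat \<Rightarrow> 't \<Rightarrow> 't" where "anc k \<equiv> up (r ^ k)"

lemma power_antimono: "k \<le> n \<Longrightarrow> r ^ n \<le> r ^ k"
  using r_pos r_less by (simp add: power_decreasing)

lemma power_arbitrarily_small: "0 < t \<Longrightarrow> \<exists>n. r ^ n \<le> t"
  using real_arch_pow_inv[of t r] r_less by (auto intro: less_imp_le)

lemma V_iff: "a \<in> V \<longleftrightarrow> snd a \<in> \<Lambda> (r ^ fst a)"
  by (cases a) (auto simp: resolution_def)

lemma root_in_V: "(0, \<phi>) \<in> V"
  by (simp add: V_iff scale_ge_1)

lemma anc_in: "\<lbrakk>w \<in> \<Lambda> (r ^ n); k \<le> n\<rbrakk> \<Longrightarrow> anc k w \<in> \<Lambda> (r ^ k)"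
  using up_scale power_antimono by blast

lemma anc_anc: "\<lbrakk>w \<in> \<Lambda> (r ^ n); k \<le> j; j \<le> n\<rbrakk> \<Longrightarrow> anc k (anc j w) = anc k w"
  using up_up[OF scale_in order_trans[OF scale_le power_antimono] power_antimono] by blast

lemma up_1 [simp]: "up 1 w = \<phi>"
  by (simp add: up_def)

text \<open>An ancestor in the coarser scale exists because \<open>w\<close> has weight at most
  \<open>r ^ m\<close>, and \<open>up_unique\<close> admits no other; this justifies the
  \<open>THE\<close>.\<close>

lemma res_parent_eq:
  assumes "w \<in> \<Lambda> (r ^ Suc m)"
  shows "res_parent T A \<phi> g r m w = anc m w"
  unfolding res_parent_def
proof (rule the_equality)
  have "w \<in> T" using assms scale_in by blast
  then obtain i where "anc m w = (par ^^ i) w" using up_ancestor by blast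
  then show "anc m w \<in> \<Lambda> (r ^ m) \<and> w \<in> subtree T A \<phi> (anc m w)"
    using anc_in[OF assms, of m] \<open>w \<in> T\<close> by (auto simp: subtree_iff)
  show "v = anc m w" if "v \<in> \<Lambda> (r ^ m) \<and> w \<in> subtree T A \<phi> v" for v
    using that up_unique[OF \<open>w \<in> T\<close>] by (auto simp: subtree_iff)
qed

lemma res_child_iff:
  "b \<in> V \<Longrightarrow> res_child T A \<phi> g r a b \<longleftrightarrow> fst b = Suc (fst a) \<and> snd a = anc (fst a) (snd b)"
  using res_parent_eq[of "snd b" "fst a"] by (auto simp: res_child_def V_iff)

lemma tree_edge_cases:
  assumes "a \<in> V" "b \<in> V" "TE a b"
  obtains "fst b = Suc (fst a)" "snd a = anc (fst a) (snd b)"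
  | "fst a = Suc (fst b)" "snd b = anc (fst b) (snd a)"
  using assms by (auto simp: res_tree_edge_def res_child_iff)

lemma sym_tree_steps: "sym (steps V TE)"
  by (auto simp: sym_def steps_def res_tree_edge_def)

lemma sym_steps: "sym (steps V E)"
  by (auto simp: sym_def steps_def res_edge_def res_tree_edge_def)

lemma steps_tree_subset: "steps V TE \<subseteq> steps V E"
  by (auto simp: steps_def res_edge_def)

lemma ancestor_walk: "w \<in> \<Lambda> (r ^ (k + j)) \<Longrightarrow> ((k + j, w), (k, anc k w)) \<in> steps V TE ^^ j"
proof (induction j arbitrary: w)
  case 0
  then show ?case by (simp add: up_self)
next
  case (Suc j)
  let ?w = "anc (k + j) w"
  have w: "?w \<in> \<Lambda> (r ^ (k + j))" using anc_in[OF Suc.prems, of "k + j"] by simp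
  have "((k + Suc j, w), (k + j, ?w)) \<in> steps V TE"
    using w Suc.prems by (simp add: steps_def V_iff res_tree_edge_def res_child_iff)
  moreover have "anc k ?w = anc k w" using anc_anc[OF Suc.prems, of k "k + j"] by simp
  then have "((k + j, ?w), (k, anc k w)) \<in> steps V TE ^^ j" using Suc.IH[OF w] by simp
  ultimately show ?case by (rule relpow_Suc_I2)
qed

text \<open>At positive levels each link is a horizontal edge. Level 0 has no such edges but
  consists of the root alone, where the chain collapses to the empty walk; hence only
  \<open>h' \<le> h\<close>.\<close>

lemma meet_walk:
  assumes "(w, v) \<in> meet (r ^ k) ^^ h" "w \<in> \<Lambda> (r ^ k)"
  shows "\<exists>h'\<le>h. ((k, w), (k, v)) \<in> steps V E ^^ h'"
proof (cases k)
  case 0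
  then have "v = w" using assms meet_relpow_in[OF assms] by (simp add: scale_ge_1)
  then show ?thesis by (intro exI[of _ 0]) auto
next
  case (Suc j)
  have "((k, w), (k, v)) \<in> steps V E ^^ h" using assms(1)
  proof (induction h arbitrary: v)
    case (Suc h)
    then obtain u where u: "(w, u) \<in> meet (r ^ k) ^^ h" "(u, v) \<in> meet (r ^ k)" by auto
    then have "((k, u), (k, v)) \<in> steps V E"
      using \<open>k = Suc j\<close> by (auto simp: steps_def V_iff res_edge_def meet_def)
    with Suc.IH[OF u(1)] show ?case by auto
  qed simp
  then show ?thesis by blast
qed

text \<open>Climb from both ends to level \<open>k\<close> and cross there along the chain. The
  bound is additive to avoid truncated subtraction; \<open>k = 0\<close> yields
  connectedness.\<close>

lemma res_dist_le:
  assumes "w \<in> \<Lambda> (r ^ n)" "v \<in> \<Lambda> (r ^ m)" "k \<le> n" "k \<le> m"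
    and meet: "(anc k w, anc k v) \<in> meet (r ^ k) ^^ h"
  shows "\<exists>N. ((n, w), (m, v)) \<in> steps V E ^^ N"
    and "graph_dist V E (n, w) (m, v) + 2 * k \<le> n + m + h"
proof -
  obtain h' where h': "h' \<le> h" "((k, anc k w), (k, anc k v)) \<in> steps V E ^^ h'"
    using meet_walk[OF meet] anc_in[OF assms(1,3)] by blast
  have "((n, w), (k, anc k w)) \<in> steps V E ^^ (n - k)"
    using relpow_mono_rel[OF ancestor_walk steps_tree_subset, of w k "n - k"] assms by simp
  moreover have "((k, anc k v), (m, v)) \<in> steps V E ^^ (m - k)"
    using relpow_sym[OF sym_steps relpow_mono_rel[OF ancestor_walk steps_tree_subset, of v k "m - k"]] assms
    by simp
  ultimately have walk: "((n, w), (m, v)) \<in> steps V E ^^ (n - k + h' + (m - k))"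
    using h'(2) by (blast intro: relpow_trans)
  then show "\<exists>N. ((n, w), (m, v)) \<in> steps V E ^^ N" by blast
  have "graph_dist V E (n, w) (m, v) \<le> n - k + h' + (m - k)"
    by (rule graph_dist_le[OF _ walk]) (simp add: V_iff assms)
  then show "graph_dist V E (n, w) (m, v) + 2 * k \<le> n + m + h" using h'(1) assms by linarith
qed

text \<open>A walk can be pushed up to the lowest level it visits without getting longer.\<close>

lemma walk_to_meet:
  assumes "((n, w), (m, v)) \<in> steps V E ^^ N" "w \<in> \<Lambda> (r ^ n)"
  shows "\<exists>k h. k \<le> n \<and> k \<le> m \<and> (anc k w, anc k v) \<in> meet (r ^ k) ^^ h \<and> n + m + h \<le> N + 2 * k"
  using assms(1)
proof (induction N arbitrary: m v)
  case 0
  then show ?case by (intro exI[of _ n] exI[of _ 0]) auto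
next
  case (Suc N)
  then obtain m' v' where walk: "((n, w), (m', v')) \<in> steps V E ^^ N" and
    step: "((m', v'), (m, v)) \<in> steps V E" by auto
  obtain k h where k: "k \<le> n" "k \<le> m'" "(anc k w, anc k v') \<in> meet (r ^ k) ^^ h" "n + m' + h \<le> N + 2 * k"
    using Suc.IH[OF walk] by blast
  have V: "v' \<in> \<Lambda> (r ^ m')" "v \<in> \<Lambda> (r ^ m)" using step by (auto simp: steps_def V_iff)
  have "TE (m', v') (m, v) \<or> m = m' \<and> K v' \<inter> K v \<noteq> {}" using step by (auto simp: steps_def res_edge_def)
  then consider (down) "m = Suc m'" "v' = anc m' v" | (up) "m' = Suc m" "v = anc m v'"
    | (level) "m = m'" "K v' \<inter> K v \<noteq> {}"
    using tree_edge_cases[of "(m', v')" "(m, v)"] V by (auto simp: V_iff)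
  then show ?case
  proof cases
    case down
    then have "anc k v' = anc k v" using anc_anc[OF V(2), of k m'] k(2) by simp
    with k down show ?thesis by (intro exI[of _ k] exI[of _ h]) auto
  next
    case up
    show ?thesis
    proof (cases "k \<le> m")
      case True
      then have "anc k v' = anc k v" using anc_anc[OF V(1), of k m] up by simp
      with k up True show ?thesis by (intro exI[of _ k] exI[of _ h]) auto
    next
      case False
      \<comment> \<open>The step leaves level \<open>k\<close> towards the root, so the whole chain
        is pushed up one level with the same \<open>h\<close>. The loss of 2 in \<open>2 * k\<close>
        is paid by the lower end level and by the step itself.\<close>
      then have "k = Suc m" using k(2) up by simp
      have "anc m (anc k w) = anc m w" "anc m (anc k v') = anc m v'"
        using anc_anc[OF assms(2), of m k] anc_anc[OF V(1), of m k] k \<open>k = Suc m\<close> by auto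
      moreover have "(anc m (anc k w), anc m (anc k v')) \<in> meet (r ^ m) ^^ h"
        by (rule meet_relpow_up[OF k(3)]) (use power_antimono \<open>k = Suc m\<close> in auto)
      moreover have "anc m v = v" using V(2) by (rule up_self)
      ultimately have "(anc m w, anc m v) \<in> meet (r ^ m) ^^ h" using up by simp
      with k up \<open>k = Suc m\<close> show ?thesis by (intro exI[of _ m] exI[of _ h]) auto
    qed
  next
    case level
    then have "(v', v) \<in> meet (r ^ m)" using V by (auto simp: meet_def)
    then have "(anc k v', anc k v) \<in> meet (r ^ k)"
      by (rule meet_up) (use k(2) level power_antimono in auto)
    then have "(anc k w, anc k v) \<in> meet (r ^ k) ^^ Suc h" using k(3) by auto
    with k level show ?thesis by (intro exI[of _ k] exI[of _ "Suc h"]) auto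
  qed
qed

text \<open>The ancestor walk gives one inequality, the level as a potential the other. The relation
  \<open>E'\<close> is left open to cover both the tree, needed for rays, and the full graph, needed
  for Gromov products.\<close>

lemma root_dist:
  assumes "w \<in> \<Lambda> (r ^ n)" "\<And>a b. TE a b \<Longrightarrow> E' a b" "\<And>a b. E' a b \<Longrightarrow> fst b \<le> Suc (fst a)"
  shows "graph_dist V E' (0, \<phi>) (n, w) = n"
proof -
  have "((0, \<phi>), (n, w)) \<in> steps V TE ^^ n"
    using relpow_sym[OF sym_tree_steps ancestor_walk, of w 0 n] assms(1) by simp
  moreover have "steps V TE \<subseteq> steps V E'" using assms(2) by (auto simp: steps_def)
  ultimately have walk: "((0, \<phi>), (n, w)) \<in> steps V E' ^^ n" by (rule relpow_mono_rel)
  have "fst (n, w) \<le> fst (0::nat, \<phi>) + graph_dist V E' (0, \<phi>) (n, w)"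
    by (rule relpow_potential_le[of V E'])
      (use assms(3) relpow_graph_dist[OF root_in_V walk] in auto)
  with graph_dist_le[OF root_in_V walk] show ?thesis by simp
qed

lemma tree_edge_level: "TE a b \<Longrightarrow> fst b \<le> Suc (fst a)"
  by (auto simp: res_tree_edge_def res_child_def)

lemma root_dist_res: "w \<in> \<Lambda> (r ^ n) \<Longrightarrow> graph_dist V E (0, \<phi>) (n, w) = n"
  by (rule root_dist) (auto simp: res_edge_def dest: tree_edge_level)

lemma gromov_ge:
  assumes "w \<in> \<Lambda> (r ^ n)" "v \<in> \<Lambda> (r ^ m)" "k \<le> n" "k \<le> m"
    and "(anc k w, anc k v) \<in> meet (r ^ k) ^^ h"
  shows "real k - real h / 2 \<le> gp (n, w) (m, v)"
proof -
  have "real (graph_dist V E (n, w) (m, v) + 2 * k) \<le> real (n + m + h)"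
    using res_dist_le(2)[OF assms] by (simp only: of_nat_le_iff)
  then show ?thesis using root_dist_res assms(1,2) by (simp add: gromov_product_def)
qed

text \<open>By \<open>walk_to_meet\<close> a shortest walk has length at least
  \<open>n + m + h - 2 * k\<close>, and distances to the root are levels. With
  \<open>gromov_ge\<close>, the product is the maximum of
  \<open>real k - real h / 2\<close>.\<close>

lemma gromov_attained:
  assumes "w \<in> \<Lambda> (r ^ n)" "v \<in> \<Lambda> (r ^ m)"
  obtains k h where "k \<le> n" "k \<le> m" "(anc k w, anc k v) \<in> meet (r ^ k) ^^ h"
    "gp (n, w) (m, v) \<le> real k - real h / 2"
proof -
  have "(n, w) \<in> V" using assms by (simp add: V_iff)
  \<comment> \<open>All vertices share the ancestor \<open>\<phi>\<close>, so level 0 with the empty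
    chain supplies a walk.\<close>
  moreover obtain N where "((n, w), (m, v)) \<in> steps V E ^^ N"
    using res_dist_le(1)[OF assms, of 0 0] by auto
  ultimately have "((n, w), (m, v)) \<in> steps V E ^^ graph_dist V E (n, w) (m, v)"
    by (rule relpow_graph_dist)
  then obtain k h where k: "k \<le> n" "k \<le> m" "(anc k w, anc k v) \<in> meet (r ^ k) ^^ h"
    and le: "n + m + h \<le> graph_dist V E (n, w) (m, v) + 2 * k"
    using walk_to_meet assms(1) by blast
  have "real (n + m + h) \<le> real (graph_dist V E (n, w) (m, v) + 2 * k)"
    using le by (simp only: of_nat_le_iff)
  then have "gp (n, w) (m, v) \<le> real k - real h / 2"
    using root_dist_res assms by (simp add: gromov_product_def)
  with k that show thesis by blast
qed

section \<open>Rays of the resolution and the points they define\<close>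

subsection \<open>Rays and the boundary product\<close>

text \<open>Tree distance to the root is the level, so a geodesic ray is at level \<open>n\<close>
  at time \<open>n\<close>. Each of its edges then goes from parent to child, and earlier vertices
  are the ancestors of later ones.\<close>

lemma res_ray:
  assumes "\<omega> \<in> res_rays T A \<phi> g r"
  shows "fst (\<omega> n) = n" "snd (\<omega> n) \<in> \<Lambda> (r ^ n)" "k \<le> n \<Longrightarrow> anc k (snd (\<omega> n)) = snd (\<omega> k)"
proof -
  have ray: "\<omega> \<in> geodesic_rays V TE (0, \<phi>)" using assms by (simp add: res_rays_def)
  have V: "\<omega> n \<in> V" for n using geodesic_rays_step(2)[OF ray] .
  have level: "fst (\<omega> n) = n" for n
  proof -
    have "graph_dist V TE (0, \<phi>) (fst (\<omega> n), snd (\<omega> n)) = fst (\<omega> n)"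
      by (rule root_dist) (use V[of n] tree_edge_level in \<open>auto simp: V_iff\<close>)
    with geodesic_rays_step(4)[OF ray, of n] show ?thesis by simp
  qed
  have scale: "snd (\<omega> n) \<in> \<Lambda> (r ^ n)" for n using V[of n] level[of n] by (simp add: V_iff)
  have child: "snd (\<omega> n) = anc n (snd (\<omega> (Suc n)))" for n
    using tree_edge_cases[OF V[of n] V[of "Suc n"] geodesic_rays_step(3)[OF ray]] level[of n] level[of "Suc n"]
    by fastforce
  show "fst (\<omega> n) = n" "snd (\<omega> n) \<in> \<Lambda> (r ^ n)" by (rule level, rule scale)
  show "anc k (snd (\<omega> n)) = snd (\<omega> k)" if "k \<le> n"
    using that
  proof (induction n)
    case 0
    then show ?case using scale[of 0] by (simp add: scale_ge_1)
  next
    case (Suc n)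
    show ?case
    proof (cases "k = Suc n")
      case True
      then show ?thesis using up_self[OF scale] by simp
    next
      case False
      then show ?thesis
        using Suc child[of n] anc_anc[OF scale[of "Suc n"], of k n] by simp
    qed
  qed
qed

text \<open>The partition axiom concerns rays of \<open>T\<close>, so this is shown through scales:
  compactness gives a common point, and two of them would share cells at arbitrarily small scales,
  against \<open>near_separates\<close>.\<close>

lemma res_ray_point:
  assumes "\<omega> \<in> res_rays T A \<phi> g r"
  shows "(\<Inter>m. K (snd (\<omega> m))) = {ray_point K \<omega>}"
proof -
  let ?C = "\<lambda>m. K (snd (\<omega> m))"
  have T: "snd (\<omega> m) \<in> T" for m using res_ray(2)[OF assms] scale_in by blast
  have "decseq ?C"
    using K_up[OF T] res_ray(3)[OF assms] by (intro decseq_SucI) (metis le_SucI le_refl)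
  then have "(\<Inter>m. ?C m) \<noteq> {}"
    by (intro compact_space_imp_nest[OF compact_X]) (use T K_closed K_not_empty in auto)
  moreover have "x = y" if xy: "x \<in> (\<Inter>m. ?C m)" "y \<in> (\<Inter>m. ?C m)" for x y
  proof (rule ccontr)
    assume "x \<noteq> y"
    moreover have "x \<in> S" "y \<in> S" using xy K_subset[OF T] by blast+
    ultimately obtain t where t: "0 < t" "\<And>s. s \<le> t \<Longrightarrow> \<not> near s 0 x y" using near_separates by metis
    obtain n where "r ^ n \<le> t" using power_arbitrarily_small[OF t(1)] by blast
    moreover have "near (r ^ n) 0 x y" using xy
      by (intro nearI[OF res_ray(2)[OF assms, of n]]) auto
    ultimately show False using t(2) by blast
  qed
  ultimately obtain x where "(\<Inter>m. ?C m) = {x}" by blast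
  then show ?thesis by (simp add: ray_point_def)
qed

text \<open>Up to level \<open>k\<close> the ray is forced to consist of the ancestors of
  \<open>w\<close>; beyond it, \<open>K_down\<close> chooses a child whose cell still contains
  \<open>x\<close>.\<close>

lemma res_ray_through:
  assumes "w \<in> \<Lambda> (r ^ k)" "x \<in> K w"
  obtains \<omega> where "\<omega> \<in> res_rays T A \<phi> g r" "\<omega> k = (k, w)" "ray_point K \<omega> = x"
proof -
  have "\<exists>c. \<forall>j. (c j \<in> \<Lambda> (r ^ (k + j)) \<and> x \<in> K (c j) \<and> (j = 0 \<longrightarrow> c j = w)) \<and> anc (k + j) (c (Suc j)) = c j"
  proof (rule dependent_nat_choice, goal_cases)
    case 1
    then show ?case using assms by auto
  next
    case (2 v j)
    then obtain u where "u \<in> \<Lambda> (r ^ (k + Suc j))" "x \<in> K u" "anc (k + j) u = v"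
      using K_down[of v "r ^ (k + j)" "r ^ (k + Suc j)" x] r_pos power_antimono[of "k + j" "k + Suc j"] by auto
    then show ?case by blast
  qed
  then obtain c where c: "\<And>j. c j \<in> \<Lambda> (r ^ (k + j))" "\<And>j. x \<in> K (c j)" "c 0 = w"
    "\<And>j. anc (k + j) (c (Suc j)) = c j" by auto
  \<comment> \<open>Truncated subtraction merges both ranges: for \<open>j \<le> k\<close> the entry
    is \<open>anc j w\<close>, and for \<open>j \<ge> k\<close> it is \<open>c (j - k)\<close>,
    which \<open>anc j\<close> fixes.\<close>
  define \<omega> where "\<omega> j = (j, anc j (c (j - k)))" for j
  have V: "\<omega> j \<in> V" for j
    using anc_in[OF c(1)[of "j - k"], of j] by (simp add: V_iff \<omega>_def)
  have "anc j (anc (Suc j) (c (Suc j - k))) = anc j (c (j - k))" for j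
  proof (cases "k \<le> j")
    case True
    then have "anc (Suc j) (c (Suc (j - k))) = c (Suc (j - k))" using c(1)[of "Suc (j - k)"] by (simp add: up_self)
    moreover have "anc j (c (j - k)) = c (j - k)" using c(1)[of "j - k"] True by (simp add: up_self)
    moreover have "anc j (c (Suc (j - k))) = c (j - k)" using c(4)[of "j - k"] True by simp
    ultimately show ?thesis using True by (simp add: Suc_diff_le)
  next
    case False
    then show ?thesis using anc_anc[OF c(1)[of 0], of j "Suc j"] by simp
  qed
  then have "TE (\<omega> j) (\<omega> (Suc j))" for j
    using res_child_iff[OF V] by (simp add: res_tree_edge_def \<omega>_def)
  moreover have "\<omega> 0 = (0, \<phi>)" by (simp add: \<omega>_def)
  ultimately have ray: "\<omega> \<in> res_rays T A \<phi> g r"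
    unfolding res_rays_def using V
    by (intro geodesic_raysI[where f = fst]) (auto simp: \<omega>_def dest: tree_edge_level)
  have "x \<in> (\<Inter>m. K (snd (\<omega> m)))"
    using c(2) K_up[OF scale_in[OF c(1)]] by (auto simp: \<omega>_def)
  then have "ray_point K \<omega> = x" using res_ray_point[OF ray] by auto
  moreover have "\<omega> k = (k, w)" using up_self[OF assms(1)] by (simp add: \<omega>_def c(3))
  ultimately show thesis using that ray by blast
qed

text \<open>A pair \<open>k\<close>, \<open>h\<close> that attains the product at \<open>n\<close>,
  \<open>m\<close> remains available further along the rays, whose ancestors at level
  \<open>k\<close> do not change. The product is therefore monotone in both indices.\<close>

lemma Lim_gromov:
  assumes "\<omega> \<in> res_rays T A \<phi> g r" "\<tau> \<in> res_rays T A \<phi> g r"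
  shows "Lim (sequentially \<times>\<^sub>F sequentially) (\<lambda>(n, m). ereal (gp (\<omega> n) (\<tau> m)))
       = (SUP p. ereal (gp (\<omega> (fst p)) (\<tau> (snd p))))"
proof -
  have eq: "\<omega> n = (n, snd (\<omega> n))" "\<tau> n = (n, snd (\<tau> n))" for n
    using res_ray(1)[OF assms(1), of n] res_ray(1)[OF assms(2), of n] by (metis prod.collapse)+
  have "gp (\<omega> n) (\<tau> m) \<le> gp (\<omega> n') (\<tau> m')" if le: "n \<le> n'" "m \<le> m'" for n m n' m'
  proof -
    obtain k h where k: "k \<le> n" "k \<le> m" "(anc k (snd (\<omega> n)), anc k (snd (\<tau> m))) \<in> meet (r ^ k) ^^ h"
      "gp (n, snd (\<omega> n)) (m, snd (\<tau> m)) \<le> real k - real h / 2"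
      using gromov_attained[OF res_ray(2)[OF assms(1)] res_ray(2)[OF assms(2)]] by blast
    have "(anc k (snd (\<omega> n')), anc k (snd (\<tau> m'))) \<in> meet (r ^ k) ^^ h"
      using k le res_ray(3)[OF assms(1)] res_ray(3)[OF assms(2)] by simp
    then have "real k - real h / 2 \<le> gp (n', snd (\<omega> n')) (m', snd (\<tau> m'))"
      using k le by (intro gromov_ge[OF res_ray(2)[OF assms(1)] res_ray(2)[OF assms(2)]]) auto
    with k(4) show ?thesis using eq by simp
  qed
  then have "((\<lambda>(n, m). ereal (gp (\<omega> n) (\<tau> m))) \<longlongrightarrow> (SUP p. ereal (gp (\<omega> (fst p)) (\<tau> (snd p)))))
      (sequentially \<times>\<^sub>F sequentially)"
    by (intro tendsto_SUP_incseq2) simp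
  then show ?thesis by (intro tendsto_Lim) (auto simp: prod_filter_eq_bot)
qed

text \<open>A pair attaining the product along two rays is a chain between cells of \<open>x\<close>
  and \<open>y\<close>. Conversely, rays through the end cells of a given chain have product at
  least \<open>real k - real h / 2\<close> already at level \<open>k\<close>.\<close>

lemma boundary_product_eq:
  "boundary_product T A \<phi> K g r x y = Sup {ereal (real k - real h / 2) | k h. near (r ^ k) h x y}"
    (is "?B = Sup ?N")
proof (rule antisym)
  show "?B \<le> Sup ?N"
    unfolding boundary_product_def
  proof (rule Sup_least, clarify)
    fix \<omega> \<tau> assume rays: "\<omega> \<in> res_rays T A \<phi> g r" "\<tau> \<in> res_rays T A \<phi> g r"
      and xy: "x = ray_point K \<omega>" "y = ray_point K \<tau>"
    have "ereal (gp (\<omega> n) (\<tau> m)) \<le> Sup ?N" for n m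
    proof -
      obtain k h where k: "k \<le> n" "k \<le> m" "(anc k (snd (\<omega> n)), anc k (snd (\<tau> m))) \<in> meet (r ^ k) ^^ h"
        "gp (n, snd (\<omega> n)) (m, snd (\<tau> m)) \<le> real k - real h / 2"
        using gromov_attained[OF res_ray(2)[OF rays(1)] res_ray(2)[OF rays(2)]] by blast
      have "x \<in> K (snd (\<omega> k))" "y \<in> K (snd (\<tau> k))"
        using res_ray_point[OF rays(1)] res_ray_point[OF rays(2)] xy by blast+
      then have "near (r ^ k) h x y"
        using k(1-3) res_ray(2,3)[OF rays(1)] res_ray(3)[OF rays(2)] by (intro nearI) auto
      then have "ereal (real k - real h / 2) \<le> Sup ?N" by (intro Sup_upper) blast
      moreover have "gp (\<omega> n) (\<tau> m) \<le> real k - real h / 2"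
        using k(4) res_ray(1)[OF rays(1), of n] res_ray(1)[OF rays(2), of m] by (metis prod.collapse)
      ultimately show ?thesis by (meson ereal_less_eq(3) order_trans)
    qed
    then show "Lim (sequentially \<times>\<^sub>F sequentially) (\<lambda>(n, m). ereal (gp (\<omega> n) (\<tau> m)))
        \<le> Sup {ereal (real k - real h / 2) | k h. near (r ^ k) h (ray_point K \<omega>) (ray_point K \<tau>)}"
      unfolding Lim_gromov[OF rays] xy by (auto intro: SUP_least)
  qed
  show "Sup ?N \<le> ?B"
  proof (rule Sup_least, clarify)
    fix k h assume "near (r ^ k) h x y"
    then obtain w v where w: "w \<in> \<Lambda> (r ^ k)" "x \<in> K w" "y \<in> K v" "(w, v) \<in> meet (r ^ k) ^^ h"
      by (auto simp: near_def)
    then have v: "v \<in> \<Lambda> (r ^ k)" using meet_relpow_in by blast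
    obtain \<omega> where \<omega>: "\<omega> \<in> res_rays T A \<phi> g r" "\<omega> k = (k, w)" "ray_point K \<omega> = x"
      using res_ray_through[OF w(1,2)] .
    obtain \<tau> where \<tau>: "\<tau> \<in> res_rays T A \<phi> g r" "\<tau> k = (k, v)" "ray_point K \<tau> = y"
      using res_ray_through[OF v w(3)] .
    have "real k - real h / 2 \<le> gp (k, w) (k, v)"
      using w v by (intro gromov_ge) (auto simp: up_self)
    then have "ereal (real k - real h / 2) \<le> ereal (gp (\<omega> k) (\<tau> k))" using \<omega> \<tau> by simp
    also have "\<dots> \<le> Lim (sequentially \<times>\<^sub>F sequentially) (\<lambda>(n, m). ereal (gp (\<omega> n) (\<tau> m)))"
      unfolding Lim_gromov[OF \<omega>(1) \<tau>(1)]
      using SUP_upper[of "(k, k)" UNIV "\<lambda>p. ereal (gp (\<omega> (fst p)) (\<tau> (snd p)))"] by simp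
    also have "\<dots> \<le> ?B"
      unfolding boundary_product_def by (rule Sup_upper) (use \<omega> \<tau> in blast)
    finally show "ereal (real k - real h / 2) \<le> ?B" .
  qed
qed

end

section \<open>Real estimates, and adaptedness in terms of \<open>near\<close>\<close>

section \<open>Adapted metrics\<close>

lemma powr_less_iff_base_less_1:
  fixes r :: real
  assumes "0 < r" "r < 1"
  shows "r powr a < r powr b \<longleftrightarrow> b < a"
  using assms by (simp add: powr_def)

text \<open>Bernoulli's inequality for \<open>(1 + e) ^ h\<close>. It absorbs the number of cells of
  a chain into an exponential of any prescribed rate \<open>\<beta>\<close>.\<close>

lemma linear_le_geometric:
  fixes r \<beta> :: real
  assumes "0 < r" "r < 1" "0 < \<beta>"
  obtains C where "0 < C" "\<And>h. real (Suc h) \<le> C * r powr (- \<beta> * real h)"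
proof -
  define e where "e = r powr (- \<beta>) - 1"
  have "1 < r powr (- \<beta>)" using powr_less_iff_base_less_1[OF assms(1,2), of 0 "- \<beta>"] assms by simp
  then have e: "0 < e" by (simp add: e_def)
  have "real (Suc h) \<le> (1 + 1 / e) * r powr (- \<beta> * real h)" for h
  proof -
    have "real (Suc h) \<le> (1 + 1 / e) * (1 + real h * e)" using e by (simp add: field_simps)
    also have "\<dots> \<le> (1 + 1 / e) * (1 + e) ^ h"
      using e Bernoulli_inequality[of e h] by (intro mult_left_mono) auto
    also have "(1 + e) ^ h = r powr (- \<beta> * real h)"
      using assms by (simp add: e_def powr_powr flip: powr_realpow)
    finally show ?thesis .
  qed
  with that[of "1 + 1 / e"] e show thesis by (simp add: add_pos_pos)
qed

lemma power_bracket: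
  fixes r s :: real
  assumes "0 < r" "r < 1" "0 < s" "s \<le> 1"
  obtains k where "s \<le> r ^ k" "r ^ Suc k < s"
proof -
  have ex: "\<exists>n. r ^ n < s" using real_arch_pow_inv assms by blast
  define n where "n = (LEAST n. r ^ n < s)"
  have n: "r ^ n < s" unfolding n_def by (rule LeastI_ex[OF ex])
  then have "n \<noteq> 0" using assms by (cases n) auto
  then obtain k where k: "n = Suc k" using not0_implies_Suc by blast
  then have "\<not> r ^ k < s" using not_less_Least[of k "\<lambda>n. r ^ n < s"] by (simp add: n_def)
  with that[of k] n k show thesis by (simp del: power_Suc)
qed

text \<open>The exponent is taken even: \<open>2 ^ (2 * q)\<close> is at least
  \<open>(1 + q)^2\<close>, whose quadratic term beats \<open>c * (2 * q)\<close> once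
  \<open>q \<ge> 2 * \<bar>c\<bar>\<close>.\<close>

lemma linear_le_power2:
  fixes c :: real
  shows "\<exists>p. 5 + c * real p \<le> 2 ^ p"
proof -
  define q where "q = nat \<lceil>2 * \<bar>c\<bar>\<rceil> + 4"
  have q: "2 * \<bar>c\<bar> \<le> real q" "4 \<le> real q" unfolding q_def by linarith+
  have "1 + real q \<le> 2 ^ q" using Bernoulli_inequality[of 1 q] by simp
  then have "(1 + real q) * (1 + real q) \<le> 2 ^ q * 2 ^ q" by (intro mult_mono) auto
  also have "\<dots> = 2 ^ (2 * q)" by (simp add: mult_2 power_add)
  finally have "1 + 2 * real q + real q * real q \<le> 2 ^ (2 * q)" by (simp add: algebra_simps)
  moreover have "2 * \<bar>c\<bar> * real q \<le> real q * real q" using q by (intro mult_right_mono) auto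
  moreover have "c * real q \<le> \<bar>c\<bar> * real q" by (intro mult_right_mono) auto
  moreover have "c * real (2 * q) = 2 * (c * real q)" by simp
  moreover have "2 * \<bar>c\<bar> * real q = 2 * (\<bar>c\<bar> * real q)" by simp
  ultimately have "5 + c * real (2 * q) \<le> 2 ^ (2 * q)" using q(2) by linarith
  then show ?thesis by blast
qed

lemma epowr_le:
  assumes "0 < r" "r \<le> 1" "ereal c \<le> t"
  shows "epowr r t \<le> r powr c"
  using assms by (cases t) (auto simp: epowr_def intro: powr_mono')

text \<open>The hypothesis \<open>0 \<le> t\<close> excludes \<open>-\<infinity>\<close>, which
  \<open>real_of_ereal\<close> sends to 0.\<close>

lemma epowr_ge:
  assumes "0 < r" "r \<le> 1" "t \<le> ereal c" "0 \<le> t"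
  shows "r powr c \<le> epowr r t"
  using assms by (cases t) (auto simp: epowr_def intro: powr_mono')

context weighted_partition
begin

text \<open>Taking powers is increasing, so passing from \<open>g\<close> to its power
  \<open>\<alpha>\<close> merely relabels the scales.\<close>

lemma scale_powr:
  assumes "0 < \<alpha>" "0 < s"
  shows "scale T A \<phi> (\<lambda>w. g w powr \<alpha>) s = \<Lambda> (s powr (1 / \<alpha>))"
proof -
  have le: "g w powr \<alpha> \<le> s \<longleftrightarrow> g w \<le> s powr (1 / \<alpha>)" if "w \<in> T" for w
    using powr_le_cancel_iff powr_mono2[of \<alpha> "g w" "s powr (1 / \<alpha>)"]
      powr_mono2[of "1 / \<alpha>" "g w powr \<alpha>" s] g_pos[OF that] assms
    by (auto simp: powr_powr)
  have "1 \<le> s \<longleftrightarrow> 1 \<le> s powr (1 / \<alpha>)"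
    using le[OF root_in] assms by (simp add: g_root)
  then show ?thesis
    using le le[OF parent_in] unfolding scale_def by (auto simp: not_le[symmetric])
qed

lemma chain_nbhd_powr_iff:
  assumes "0 < \<alpha>" "0 < s"
  shows "y \<in> chain_nbhd X T A \<phi> K (\<lambda>w. g w powr \<alpha>) M x s \<longleftrightarrow> near (s powr (1 / \<alpha>)) M x y"
proof -
  have "chain_nbhd X T A \<phi> K (\<lambda>w. g w powr \<alpha>) M x s = chain_nbhd X T A \<phi> K g M x (s powr (1 / \<alpha>))"
    unfolding chain_nbhd_def scale_powr[OF assms] by (rule refl)
  then show ?thesis by (simp add: chain_nbhd_iff)
qed

text \<open>Radius and scale are matched by \<open>a1 * \<rho> = t powr \<alpha>\<close>, and
  likewise with \<open>a2\<close>; the constants of the two sides are therefore reciprocal.\<close>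

lemma adapted_powr_iff:
  assumes "0 < \<alpha>" "Metric_space S d"
  shows "adapted X T A \<phi> K M d (\<lambda>w. g w powr \<alpha>) \<longleftrightarrow>
    (\<exists>a>0. \<exists>b>0. \<forall>x\<in>S. \<forall>y\<in>S. \<forall>t>0.
       (near t M x y \<longrightarrow> d x y < a * t powr \<alpha>) \<and> (d x y < b * t powr \<alpha> \<longrightarrow> near t M x y))"
    (is "_ \<longleftrightarrow> ?R")
proof
  interpret Metric_space S d by (rule assms)
  assume "adapted X T A \<phi> K M d (\<lambda>w. g w powr \<alpha>)"
  then obtain a1 a2 where a: "0 < a1" "0 < a2"
    and sub: "\<forall>x\<in>S. \<forall>\<rho>>0.
        chain_nbhd X T A \<phi> K (\<lambda>w. g w powr \<alpha>) M x (a1 * \<rho>) \<subseteq> mball x \<rho> \<and>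
        mball x \<rho> \<subseteq> chain_nbhd X T A \<phi> K (\<lambda>w. g w powr \<alpha>) M x (a2 * \<rho>)"
    unfolding adapted_def by (elim exE conjE) (rule that; assumption)
  have "near t M x y \<Longrightarrow> d x y < 1 / a1 * t powr \<alpha>" "d x y < 1 / a2 * t powr \<alpha> \<Longrightarrow> near t M x y"
    if "x \<in> S" "y \<in> S" "0 < t" for x y t
  proof -
    have t: "(t powr \<alpha>) powr (1 / \<alpha>) = t" "0 < t powr \<alpha>" using that assms by (simp_all add: powr_powr)
    show "d x y < 1 / a1 * t powr \<alpha>" if "near t M x y"
      using sub[rule_format, OF \<open>x \<in> S\<close>, of "t powr \<alpha> / a1"] a that t
      by (auto simp: chain_nbhd_powr_iff[OF assms(1) t(2)])
    show "near t M x y" if "d x y < 1 / a2 * t powr \<alpha>"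
      using sub[rule_format, OF \<open>x \<in> S\<close>, of "t powr \<alpha> / a2"] a that t \<open>x \<in> S\<close> \<open>y \<in> S\<close>
      by (auto simp: chain_nbhd_powr_iff[OF assms(1) t(2)] subset_iff)
  qed
  with a show ?R by (intro exI[of _ "1 / a1"] exI[of _ "1 / a2"] conjI) auto
next
  interpret Metric_space S d by (rule assms)
  assume ?R
  then obtain a b where ab: "0 < a" "0 < b"
    and near: "\<And>x y t. \<lbrakk>x \<in> S; y \<in> S; 0 < t; near t M x y\<rbrakk> \<Longrightarrow> d x y < a * t powr \<alpha>"
    and ball: "\<And>x y t. \<lbrakk>x \<in> S; y \<in> S; 0 < t; d x y < b * t powr \<alpha>\<rbrakk> \<Longrightarrow> near t M x y"
    by blast
  show "adapted X T A \<phi> K M d (\<lambda>w. g w powr \<alpha>)"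
    unfolding adapted_def
  proof (intro exI conjI ballI allI impI subsetI)
    show "0 < 1 / a" "0 < 1 / b" using ab by auto
    fix x \<rho> y assume x: "x \<in> S" and \<rho>: "(0::real) < \<rho>"
    have pos: "0 < 1 / a * \<rho>" "0 < 1 / b * \<rho>" using ab \<rho> by simp_all
    show "y \<in> mball x \<rho>" if "y \<in> chain_nbhd X T A \<phi> K (\<lambda>w. g w powr \<alpha>) M x (1 / a * \<rho>)"
    proof -
      have n: "near ((1 / a * \<rho>) powr (1 / \<alpha>)) M x y"
        using that chain_nbhd_powr_iff[OF assms(1) pos(1)] by blast
      have "d x y < a * ((1 / a * \<rho>) powr (1 / \<alpha>)) powr \<alpha>"
        by (rule near[OF x _ _ n]) (use near_in[OF n] pos(1) in auto)
      then show ?thesis using near_in[OF n] ab \<rho> assms(1) by (simp add: powr_powr)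
    qed
    show "y \<in> chain_nbhd X T A \<phi> K (\<lambda>w. g w powr \<alpha>) M x (1 / b * \<rho>)" if y: "y \<in> mball x \<rho>"
    proof -
      have "near ((1 / b * \<rho>) powr (1 / \<alpha>)) M x y"
        by (rule ball[OF x]) (use y ab \<rho> assms(1) in \<open>auto simp: powr_powr\<close>)
      then show ?thesis using chain_nbhd_powr_iff[OF assms(1) pos(2)] by blast
    qed
  qed
qed

text \<open>Balls of \<open>d\<close> are sandwiched between \<open>near\<close>-neighbourhoods.
  These lie in small balls of a metric for \<open>X\<close> by \<open>near_small\<close> and contain
  open sets of \<open>X\<close> by \<open>near_open_nbhd\<close>.\<close>

lemma mtopology_eqI:
  assumes d: "Metric_space S d" and "0 < \<alpha>" "0 < a" "0 < b"
    and near: "\<And>x y t. \<lbrakk>x \<in> S; y \<in> S; 0 < t; near t M x y\<rbrakk> \<Longrightarrow> d x y < a * t powr \<alpha>"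
    and ball: "\<And>x y t. \<lbrakk>x \<in> S; y \<in> S; 0 < t; d x y < b * t powr \<alpha>\<rbrakk> \<Longrightarrow> near t M x y"
  shows "Metric_space.mtopology S d = X"
proof -
  interpret Metric_space S d by (rule d)
  obtain D where D: "Metric_space S D" "Metric_space.mtopology S D = X" using metric_exists .
  interpret D: Metric_space S D by (rule D)
  have "openin mtopology U \<longleftrightarrow> openin X U" for U
  proof
    assume U: "openin X U"
    show "openin mtopology U"
      unfolding openin_mtopology
    proof (intro conjI allI impI)
      show "U \<subseteq> S" using U openin_subset by blast
      fix x assume x: "x \<in> U"
      then have "x \<in> S" using \<open>U \<subseteq> S\<close> by blast
      obtain e where e: "0 < e" "D.mball x e \<subseteq> U"
        using U x D.openin_mtopology[of U] unfolding D(2) by blast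
      obtain t where t: "0 < t" "\<And>s x y. \<lbrakk>s \<le> t; near s M x y\<rbrakk> \<Longrightarrow> D x y < e"
        using near_small[OF D e(1)] by metis
      have "mball x (b * t powr \<alpha>) \<subseteq> U"
      proof
        fix y assume y: "y \<in> mball x (b * t powr \<alpha>)"
        then have "near t M x y" using ball t(1) by simp
        then have "D x y < e" using t(2) by blast
        then show "y \<in> U" using e(2) y by auto
      qed
      then show "\<exists>\<rho>>0. mball x \<rho> \<subseteq> U" using assms(4) t(1) by (intro exI[of _ "b * t powr \<alpha>"]) auto
    qed
  next
    assume U: "openin mtopology U"
    show "openin X U"
    proof (subst openin_subopen, intro ballI)
      fix x assume x: "x \<in> U"
      then obtain \<rho> where \<rho>: "0 < \<rho>" "mball x \<rho> \<subseteq> U" and "x \<in> S"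
        using U unfolding openin_mtopology by blast
      define t where "t = (\<rho> / a) powr (1 / \<alpha>)"
      have t: "0 < t" "a * t powr \<alpha> = \<rho>" using \<rho>(1) assms by (simp_all add: t_def powr_powr)
      obtain W where W: "openin X W" "x \<in> W" "\<And>y. y \<in> W \<Longrightarrow> near t M x y"
        using near_open_nbhd[OF \<open>x \<in> S\<close> t(1)] by metis
      have "W \<subseteq> mball x \<rho>"
      proof
        fix y assume "y \<in> W"
        then have "near t M x y" using W(3) by blast
        then show "y \<in> mball x \<rho>" using near[OF _ _ t(1)] near_in t(2) by auto
      qed
      then show "\<exists>W. openin X W \<and> x \<in> W \<and> W \<subseteq> U" using W \<rho>(2) by blast
    qed
  qed
  then show ?thesis by (simp add: topology_eq)
qed

end

section \<open>Hyperbolicity and the boundary estimate from an adapted metric\<close>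

context weighted_resolution
begin

lemma near_1: "\<lbrakk>x \<in> S; y \<in> S\<rbrakk> \<Longrightarrow> near (r ^ 0) n x y"
  by (simp add: near_ge_1)

lemma near_anc:
  assumes "w \<in> \<Lambda> (r ^ n)" "v \<in> \<Lambda> (r ^ m)" "x \<in> K w" "y \<in> K v" "k \<le> n"
    and "(anc k w, anc k v) \<in> meet (r ^ k) ^^ h"
  shows "near (r ^ k) h x y"
  using nearI[OF anc_in[OF assms(1,5)] _ _ assms(6)] K_up[OF scale_in] assms by blast

text \<open>The given chain starts and ends at arbitrary cells of \<open>x\<close> and
  \<open>y\<close>; linking these to the prescribed ancestors costs one link at each end.\<close>

lemma meet_anc_of_near:
  assumes "w \<in> \<Lambda> (r ^ n)" "v \<in> \<Lambda> (r ^ m)" "x \<in> K w" "y \<in> K v" "k \<le> n" "k \<le> m"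
    and "near (r ^ k) h x y"
  shows "(anc k w, anc k v) \<in> meet (r ^ k) ^^ Suc (Suc h)"
proof -
  obtain w' v' where w': "w' \<in> \<Lambda> (r ^ k)" "x \<in> K w'" "y \<in> K v'" "(w', v') \<in> meet (r ^ k) ^^ h"
    using assms(7) by (auto simp: near_def)
  have "v' \<in> \<Lambda> (r ^ k)" using w' meet_relpow_in by blast
  moreover have "x \<in> K (anc k w)" "y \<in> K (anc k v)" using K_up[OF scale_in] assms by blast+
  ultimately have "(anc k w, w') \<in> meet (r ^ k)" "(v', anc k v) \<in> meet (r ^ k)"
    using w' anc_in[OF assms(1,5)] anc_in[OF assms(2,6)] by (auto simp: meet_def)
  with w'(4) show ?thesis by (meson relpow_Suc_I relpow_Suc_I2)
qed

context
  fixes d M \<alpha>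
  assumes d: "Metric_space S d" and \<alpha>: "0 < \<alpha>"
    and adapted: "adapted X T A \<phi> K M d (\<lambda>w. g w powr \<alpha>)"
begin

text \<open>The chain has \<open>h + 1\<close> cells of diameter at most a constant times
  \<open>r powr (\<alpha> * k)\<close>. The factor \<open>h + 1\<close> is absorbed at rate
  \<open>\<alpha> / 2\<close>, which produces the \<open>h / 2\<close> of the Gromov
  product.\<close>

lemma adapted_chain_dist:
  obtains C where "0 < C"
    "\<And>k h x y. near (r ^ k) h x y \<Longrightarrow> d x y \<le> C * r powr (\<alpha> * (real k - real h / 2))"
proof -
  obtain a where a: "0 < a" "\<And>x y t. \<lbrakk>x \<in> S; y \<in> S; 0 < t; near t M x y\<rbrakk> \<Longrightarrow> d x y < a * t powr \<alpha>"
    using adapted unfolding adapted_powr_iff[OF \<alpha> d] by blast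
  obtain C where C: "0 < C" "\<And>h. real (Suc h) \<le> C * r powr (- (\<alpha> / 2) * real h)"
    using linear_le_geometric[OF r_pos r_less, of "\<alpha> / 2"] \<alpha> by auto
  have "d x y \<le> (C * a) * r powr (\<alpha> * (real k - real h / 2))" if near: "near (r ^ k) h x y" for k h x y
  proof -
    obtain w v where w: "(w, v) \<in> meet (r ^ k) ^^ h" "w \<in> \<Lambda> (r ^ k)" "x \<in> K w" "y \<in> K v"
      using near by (auto simp: near_def)
    have cell: "d x y \<le> a * (r ^ k) powr \<alpha>" if "w \<in> \<Lambda> (r ^ k)" "x \<in> K w" "y \<in> K w" for w x y
    proof -
      have "near (r ^ k) M x y" using that meet_relpow_refl by (intro nearI)
      then show ?thesis using a(2)[of x y "r ^ k"] near_in r_pos by fastforce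
    qed
    have "d x y \<le> real (Suc h) * (a * (r ^ k) powr \<alpha>)"
      by (rule relpow_meet_dist[OF d cell w])
    also have "\<dots> \<le> (C * r powr (- (\<alpha> / 2) * real h)) * (a * (r ^ k) powr \<alpha>)"
      using C(2) a(1) by (intro mult_right_mono) auto
    also have "(r ^ k) powr \<alpha> = r powr (\<alpha> * real k)"
      using r_pos by (simp add: powr_realpow[symmetric] powr_powr mult.commute)
    also have "(C * r powr (- (\<alpha> / 2) * real h)) * (a * r powr (\<alpha> * real k)) =
        C * a * (r powr (- (\<alpha> / 2) * real h) * r powr (\<alpha> * real k))" by simp
    also have "\<dots> = C * a * r powr (\<alpha> * (real k - real h / 2))"
      unfolding powr_add[symmetric] by (simp add: algebra_simps)
    finally show ?thesis .
  qed
  with that[of "C * a"] C(1) a(1) show thesis by simp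
qed

text \<open>A converse to \<open>adapted_chain_dist\<close>, with all constants absorbed in a shift
  of the level. The clause \<open>real p \<le> t \<or> p = 0\<close> ensures that vertices at levels
  at least \<open>t\<close> have ancestors at level \<open>p\<close>.\<close>

lemma adapted_level:
  obtains n\<^sub>0 :: nat where
    "\<And>x y t. \<lbrakk>x \<in> S; y \<in> S; d x y \<le> C * r powr (\<alpha> * t)\<rbrakk> \<Longrightarrow>
       \<exists>p. near (r ^ p) M x y \<and> t - real n\<^sub>0 \<le> real p \<and> (real p \<le> t \<or> p = 0)"
proof -
  obtain b where b: "0 < b" "\<And>x y t. \<lbrakk>x \<in> S; y \<in> S; 0 < t; d x y < b * t powr \<alpha>\<rbrakk> \<Longrightarrow> near t M x y"
    using adapted unfolding adapted_powr_iff[OF \<alpha> d] by blast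
  \<comment> \<open>Chosen so that \<open>b * c powr \<alpha>\<close> exceeds \<open>C\<close>: the
    bound on \<open>d\<close> becomes the strict one that \<open>b\<close> requires, at scale
    \<open>c * r powr t\<close>.\<close>
  define c where "c = ((\<bar>C\<bar> + 1) / b) powr (1 / \<alpha>)"
  have c: "0 < c" "b * c powr \<alpha> = \<bar>C\<bar> + 1" using b(1) \<alpha> by (simp_all add: c_def powr_powr)
  obtain n where n: "r ^ n \<le> 1 / c" using power_arbitrarily_small[of "1 / c"] c(1) by auto
  have "\<exists>p. near (r ^ p) M x y \<and> t - real (Suc n) \<le> real p \<and> (real p \<le> t \<or> p = 0)"
    if xy: "x \<in> S" "y \<in> S" "d x y \<le> C * r powr (\<alpha> * t)" for x y t
  proof (cases "t < real n")
    case True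
    then show ?thesis using near_1 xy by (intro exI[of _ 0]) auto
  next
    case False
    define p where "p = nat \<lfloor>t - real n\<rfloor>"
    have p: "t - real (Suc n) \<le> real p" "real p \<le> t - real n" using False unfolding p_def by linarith+
    have "d x y < b * (c * r powr t) powr \<alpha>"
    proof -
      have "C * r powr (\<alpha> * t) < (\<bar>C\<bar> + 1) * r powr (\<alpha> * t)" using r_pos by (intro mult_strict_right_mono) auto
      also have "\<dots> = b * (c * r powr t) powr \<alpha>"
        using c r_pos by (simp add: powr_mult powr_powr mult.assoc[symmetric] mult.commute[of t])
      finally show ?thesis using xy(3) by linarith
    qed
    then have "near (c * r powr t) M x y" using b(2) xy(1,2) c(1) r_pos by simp
    moreover have "c * r powr t \<le> r ^ p"
    proof -
      have "c * r ^ n \<le> 1" using n c(1) by (simp add: field_simps)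
      have "c * r powr t = (c * r ^ n) * r powr (t - real n)"
        using r_pos by (simp add: powr_diff powr_realpow)
      also have "\<dots> \<le> 1 * r powr (t - real n)" using \<open>c * r ^ n \<le> 1\<close> by (intro mult_right_mono) auto
      also have "\<dots> \<le> r powr real p" using p r_pos r_less by (simp add: powr_mono')
      finally show ?thesis using r_pos by (simp add: powr_realpow)
    qed
    ultimately have "near (r ^ p) M x y" by (rule near_up)
    then show ?thesis using p by (intro exI[of _ p]) auto
  qed
  with that show thesis by blast
qed

text \<open>With points \<open>x\<close>, \<open>y\<close>, \<open>z\<close> in the three cells, the
  products with \<open>u\<close> bound the distances to \<open>z\<close>. The triangle inequality
  doubles the constant, and \<open>adapted_level\<close> returns a chain from \<open>x\<close> to
  \<open>y\<close> of \<open>M\<close> links at level at least \<open>t - real n\<^sub>0\<close>;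
  two links at its ends account for \<open>M + 2\<close>.\<close>

lemma adapted_imp_hyperbolic: "hyperbolic_resolution T A \<phi> K g r"
proof -
  interpret Metric_space S d by (rule d)
  obtain C where C: "0 < C"
    "\<And>k h x y. near (r ^ k) h x y \<Longrightarrow> d x y \<le> C * r powr (\<alpha> * (real k - real h / 2))"
    using adapted_chain_dist by blast
  obtain n\<^sub>0 where n\<^sub>0: "\<And>x y t. \<lbrakk>x \<in> S; y \<in> S; d x y \<le> (2 * C) * r powr (\<alpha> * t)\<rbrakk> \<Longrightarrow>
       \<exists>p. near (r ^ p) M x y \<and> t - real n\<^sub>0 \<le> real p \<and> (real p \<le> t \<or> p = 0)"
    using adapted_level[of "2 * C"] by metis
  have "min (gp (n, w) (l, u)) (gp (l, u) (m, v)) - (real n\<^sub>0 + real (M + 2) / 2) \<le> gp (n, w) (m, v)"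
    if w: "w \<in> \<Lambda> (r ^ n)" and v: "v \<in> \<Lambda> (r ^ m)" and u: "u \<in> \<Lambda> (r ^ l)" for n w m v l u
  proof -
    obtain x y z where xyz: "x \<in> K w" "y \<in> K v" "z \<in> K u"
      using K_not_empty scale_in w v u by (meson ex_in_conv)
    then have S: "x \<in> S" "y \<in> S" "z \<in> S" using K_subset[OF scale_in] w v u by blast+
    obtain k1 h1 where 1: "k1 \<le> n" "k1 \<le> l" "(anc k1 w, anc k1 u) \<in> meet (r ^ k1) ^^ h1"
      "gp (n, w) (l, u) \<le> real k1 - real h1 / 2"
      using gromov_attained[OF w u] .
    obtain k2 h2 where 2: "k2 \<le> l" "k2 \<le> m" "(anc k2 u, anc k2 v) \<in> meet (r ^ k2) ^^ h2"
      "gp (l, u) (m, v) \<le> real k2 - real h2 / 2"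
      using gromov_attained[OF u v] .
    define t where "t = min (real k1 - real h1 / 2) (real k2 - real h2 / 2)"
    have mono: "C * r powr (\<alpha> * t') \<le> C * r powr (\<alpha> * t)" if "t \<le> t'" for t'
      using that C(1) r_pos r_less \<alpha> by (intro mult_left_mono powr_mono') auto
    have "d x z \<le> C * r powr (\<alpha> * t)"
      using C(2)[OF near_anc[OF w u xyz(1,3) 1(1,3)]] mono[of "real k1 - real h1 / 2"] by (simp add: t_def)
    moreover have "d z y \<le> C * r powr (\<alpha> * t)"
      using C(2)[OF near_anc[OF u v xyz(3,2) 2(1,3)]] mono[of "real k2 - real h2 / 2"] by (simp add: t_def)
    ultimately have "d x y \<le> (2 * C) * r powr (\<alpha> * t)" using triangle[OF S(1,3,2)] by simp
    then obtain p where p: "near (r ^ p) M x y" "t - real n\<^sub>0 \<le> real p" "real p \<le> t \<or> p = 0"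
      using n\<^sub>0 S by blast
    have "t \<le> real k1" "t \<le> real k2" by (auto simp: t_def)
    then have "p \<le> n" "p \<le> m" using p(3) 1(1) 2(2) by linarith+
    then have "real p - real (Suc (Suc M)) / 2 \<le> gp (n, w) (m, v)"
      using meet_anc_of_near[OF w v xyz(1,2) _ _ p(1)] by (intro gromov_ge[OF w v]) auto
    moreover have "min (gp (n, w) (l, u)) (gp (l, u) (m, v)) \<le> t" using 1(4) 2(4) by (auto simp: t_def)
    ultimately show ?thesis using p(2) by simp
  qed
  then show ?thesis
    unfolding hyperbolic_resolution_def hyperbolic_graph_def
    by (intro exI[of _ "real n\<^sub>0 + real (M + 2) / 2"]) (auto simp: V_iff)
qed

lemma delta_eq: "delta X T A \<phi> K g M x y = Inf {s \<in> {0<..1}. near s M x y}"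
  by (simp add: delta_def chain_nbhd_iff)

text \<open>A chain of \<open>M\<close> links at level \<open>k\<close> bounds \<open>(x|y)\<close>
  below by \<open>k - M / 2\<close>. Conversely, any chain with \<open>h\<close> links at level
  \<open>k\<close> bounds \<open>d\<close>, and \<open>adapted_level\<close> turns this into a chain
  of \<open>M\<close> links at a level at least \<open>k - h / 2 - n\<^sub>0\<close>.\<close>

lemma adapted_boundary_product:
  "\<exists>c\<^sub>1>0. \<exists>c\<^sub>2>0. \<forall>x\<in>S. \<forall>y\<in>S.
     c\<^sub>1 * delta X T A \<phi> K g M x y \<le> epowr r (boundary_product T A \<phi> K g r x y) \<and>
     epowr r (boundary_product T A \<phi> K g r x y) \<le> c\<^sub>2 * delta X T A \<phi> K g M x y"
proof -
  obtain C where C: "0 < C"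
    "\<And>k h x y. near (r ^ k) h x y \<Longrightarrow> d x y \<le> C * r powr (\<alpha> * (real k - real h / 2))"
    using adapted_chain_dist by blast
  obtain n\<^sub>0 where n\<^sub>0: "\<And>x y t. \<lbrakk>x \<in> S; y \<in> S; d x y \<le> C * r powr (\<alpha> * t)\<rbrakk> \<Longrightarrow>
       \<exists>p. near (r ^ p) M x y \<and> t - real n\<^sub>0 \<le> real p \<and> (real p \<le> t \<or> p = 0)"
    using adapted_level[of C] by metis
  define c\<^sub>1 where "c\<^sub>1 = r ^ n\<^sub>0"
  \<comment> \<open>The \<open>1\<close> pays for rounding \<open>s\<close> to a power of
    \<open>r\<close>, the \<open>M / 2\<close> for the length of the chain.\<close>
  define c\<^sub>2 where "c\<^sub>2 = r powr (- 1 - real M / 2)"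
  have c: "0 < c\<^sub>1" "0 < c\<^sub>2" using r_pos by (auto simp: c\<^sub>1_def c\<^sub>2_def)
  have "c\<^sub>1 * delta X T A \<phi> K g M x y \<le> epowr r (boundary_product T A \<phi> K g r x y) \<and>
     epowr r (boundary_product T A \<phi> K g r x y) \<le> c\<^sub>2 * delta X T A \<phi> K g M x y"
    if xy: "x \<in> S" "y \<in> S" for x y
  proof
    define B where "B = boundary_product T A \<phi> K g r x y"
    define \<delta> where "\<delta> = delta X T A \<phi> K g M x y"
    let ?D = "{s \<in> {0<..1}. near s M x y}"
    have \<delta>: "\<delta> = Inf ?D" by (simp add: \<delta>_def delta_eq)
    have D_ne: "1 \<in> ?D" using near_1[OF xy] by simp
    have bdd: "bdd_below ?D" by (rule bdd_belowI[of _ 0]) auto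
    have B_ge: "ereal (real k - real h / 2) \<le> B" if "near (r ^ k) h x y" for k h
      unfolding B_def boundary_product_eq by (rule Sup_upper) (use that in blast)
    have B_nonneg: "0 \<le> B" using B_ge[OF near_1[OF xy], of 0] by (simp add: zero_ereal_def)
    have "epowr r B / c\<^sub>2 \<le> \<delta>" unfolding \<delta>
    proof (rule cInf_greatest)
      show "?D \<noteq> {}" using D_ne by blast
      fix s assume s: "s \<in> ?D"
      obtain k where k: "s \<le> r ^ k" "r ^ Suc k < s" using power_bracket[OF r_pos r_less, of s] s by auto
      have "epowr r B \<le> r powr (real k - real M / 2)"
        using B_ge[OF near_up[OF _ k(1)]] s r_pos r_less by (intro epowr_le) auto
      also have "real k - real M / 2 = real (Suc k) + (- 1 - real M / 2)" by simp
      also have "r powr \<dots> = r ^ Suc k * c\<^sub>2"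
        unfolding powr_add c\<^sub>2_def using r_pos by (simp only: powr_realpow)
      also have "\<dots> \<le> s * c\<^sub>2" using k(2) c by (intro mult_right_mono) auto
      finally show "epowr r B / c\<^sub>2 \<le> s" using c by (simp add: field_simps)
    qed
    then show "epowr r B \<le> c\<^sub>2 * \<delta>" using c by (simp add: field_simps)
    show "c\<^sub>1 * \<delta> \<le> epowr r B"
    proof (cases "\<delta> \<le> 0")
      case True
      then have "c\<^sub>1 * \<delta> \<le> 0" using c by (simp add: mult_nonneg_nonpos)
      also have "0 \<le> epowr r B" by (simp add: epowr_def)
      finally show ?thesis .
    next
      case False
      \<comment> \<open>The logarithm needs \<open>\<delta>\<close> positive, hence the case split.
        A bound by \<open>l\<close> on every exponent \<open>k - h / 2\<close> bounds their supremum
        \<open>B\<close>.\<close>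
      define l where "l = log r (c\<^sub>1 * \<delta>)"
      have l: "r powr l = c\<^sub>1 * \<delta>" using False c r_pos r_less by (simp add: l_def)
      have "real k - real h / 2 \<le> l" if near: "near (r ^ k) h x y" for k h
      proof -
        obtain p where p: "near (r ^ p) M x y" "real k - real h / 2 - real n\<^sub>0 \<le> real p"
          using n\<^sub>0[OF xy C(2)[OF near]] by blast
        have "\<delta> \<le> r ^ p" unfolding \<delta>
          by (rule cInf_lower[OF _ bdd]) (use p(1) r_pos r_less in \<open>auto simp: power_le_one\<close>)
        also have "\<dots> \<le> r powr (real k - real h / 2 - real n\<^sub>0)"
          using p(2) r_pos r_less by (simp add: powr_mono' powr_realpow[symmetric])
        also have "\<dots> = r powr (real k - real h / 2) / c\<^sub>1"
          using r_pos by (simp add: powr_diff powr_realpow c\<^sub>1_def)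
        finally have "r powr l \<le> r powr (real k - real h / 2)" using c l by (simp add: field_simps)
        then show ?thesis using powr_less_iff_base_less_1[OF r_pos r_less] by (meson not_less)
      qed
      then have "B \<le> ereal l" unfolding B_def boundary_product_eq by (auto intro!: Sup_least)
      then have "r powr l \<le> epowr r B" using B_nonneg r_pos r_less by (intro epowr_ge) auto
      then show ?thesis by (simp add: l)
    qed
  qed
  with c show ?thesis by blast
qed

end
end

section \<open>Contraction of chains and construction of the adapted metric\<close>

section \<open>From hyperbolicity to an adapted metric\<close>

context weighted_resolution
begin

text \<open>Halving a chain of \<open>2 ^ p\<close> links \<open>p\<close> times costs
  \<open>\<eta>\<close> per halving. The resulting \<open>M\<close> is linear in \<open>p\<close>,
  so some \<open>p\<close> has \<open>3 * M + 2 \<le> 2 ^ p\<close>, the left side being the length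
  of three \<open>M\<close>-chains joined by two links. The truncated \<open>k - n\<close> is
  harmless because level 0 joins all points.\<close>

lemma hyperbolic_contraction:
  assumes "hyperbolic_resolution T A \<phi> K g r"
  obtains M n where "1 \<le> M" "\<forall>k x y. near (r ^ k) (3 * M + 2) x y \<longrightarrow> near (r ^ (k - n)) M x y"
proof -
  obtain \<eta>0 where \<eta>0: "\<And>a b c. \<lbrakk>a \<in> V; b \<in> V; c \<in> V\<rbrakk> \<Longrightarrow> min (gp a c) (gp c b) - \<eta>0 \<le> gp a b"
    using assms unfolding hyperbolic_resolution_def hyperbolic_graph_def by blast
  define \<eta> where "\<eta> = max 0 \<eta>0"
  have \<eta>: "0 \<le> \<eta>" "\<And>a b c. \<lbrakk>a \<in> V; b \<in> V; c \<in> V\<rbrakk> \<Longrightarrow> min (gp a c) (gp c b) - \<eta> \<le> gp a b"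
    using \<eta>0 by (force simp: \<eta>_def)+
  have chain: "real k - 1 / 2 - real p * \<eta> \<le> gp (k, w) (k, v)"
    if "(w, v) \<in> meet (r ^ k) ^^ (2 ^ p)" "w \<in> \<Lambda> (r ^ k)" for k p w v
    using that
  proof (induction p arbitrary: w v)
    case 0
    then show ?case
      using gromov_ge[of w k v k k 1] meet_relpow_in[OF 0] by (simp add: up_self)
  next
    case (Suc p)
    have "(2::nat) ^ Suc p = 2 ^ p + 2 ^ p" by (simp add: power_Suc)
    then obtain u where u: "(w, u) \<in> meet (r ^ k) ^^ (2 ^ p)" "(u, v) \<in> meet (r ^ k) ^^ (2 ^ p)"
      using Suc.prems(1) by (auto simp: relpow_add)
    have in_scale: "u \<in> \<Lambda> (r ^ k)" "v \<in> \<Lambda> (r ^ k)"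
      using meet_relpow_in u Suc.prems by blast+
    have "real k - 1 / 2 - real p * \<eta> \<le> gp (k, w) (k, u)" "real k - 1 / 2 - real p * \<eta> \<le> gp (k, u) (k, v)"
      using Suc.IH u in_scale Suc.prems(2) by blast+
    moreover have "min (gp (k, w) (k, u)) (gp (k, u) (k, v)) - \<eta> \<le> gp (k, w) (k, v)"
      by (rule \<eta>(2)) (use in_scale Suc.prems(2) in \<open>auto simp: V_iff\<close>)
    ultimately show ?case by (simp add: algebra_simps)
  qed
  obtain p where p: "5 + (6 * \<eta>) * real p \<le> 2 ^ p" using linear_le_power2 by blast
  \<comment> \<open>The chain found at level \<open>j \<le> k\<close> satisfies
    \<open>k - 1/2 - p * \<eta> \<le> j - h/2\<close>, hence
    \<open>h \<le> 1 + 2 * p * \<eta>\<close>; the same inequality gives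
    \<open>k - n \<le> j\<close>.\<close>
  define M where "M = nat \<lfloor>1 + 2 * real p * \<eta>\<rfloor>"
  define n where "n = nat \<lceil>1 / 2 + real p * \<eta>\<rceil>"
  have nonneg: "0 \<le> real p * \<eta>" using \<eta>(1) by simp
  have M: "1 \<le> M" "real M \<le> 1 + 2 * (real p * \<eta>)" and M': "\<And>h::nat. real h \<le> 1 + 2 * (real p * \<eta>) \<Longrightarrow> h \<le> M"
    using nonneg unfolding M_def mult.assoc by linarith+
  have n: "1 / 2 + real p * \<eta> \<le> real n" unfolding n_def by linarith
  have "real (3 * M + 2) \<le> 5 + 6 * (real p * \<eta>)" using M(2) by simp
  also have "\<dots> \<le> real (2 ^ p)" using p by (simp add: algebra_simps)
  finally have le: "3 * M + 2 \<le> 2 ^ p" by (simp only: of_nat_le_iff)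
  have "near (r ^ (k - n)) M x y" if near: "near (r ^ k) (3 * M + 2) x y" for k x y
  proof -
    obtain w v where w: "w \<in> \<Lambda> (r ^ k)" "x \<in> K w" "y \<in> K v" "(w, v) \<in> meet (r ^ k) ^^ (2 ^ p)"
      using near_mono[OF near le] by (auto simp: near_def)
    then have v: "v \<in> \<Lambda> (r ^ k)" using meet_relpow_in by blast
    obtain j h where j: "j \<le> k" "(anc j w, anc j v) \<in> meet (r ^ j) ^^ h" "gp (k, w) (k, v) \<le> real j - real h / 2"
      using gromov_attained[OF w(1) v] by metis
    have jh: "real k - 1 / 2 - real p * \<eta> \<le> real j - real h / 2" using chain[OF w(4,1)] j(3) by simp
    have "real h \<le> 1 + 2 * (real p * \<eta>)" using jh j(1) by simp
    then have "near (r ^ j) M x y" using near_mono[OF near_anc[OF w(1) v w(2,3) j(1,2)]] M' by blast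
    moreover have "k - n \<le> j" using jh n by linarith
    ultimately show ?thesis using near_up power_antimono by blast
  qed
  with M(1) that show thesis by blast
qed

lemma near_level_bounded:
  assumes "x \<in> S" "y \<in> S" "x \<noteq> y"
  obtains N where "\<And>k. near (r ^ k) M x y \<Longrightarrow> k \<le> N"
proof -
  obtain t where t: "0 < t" "\<And>s. s \<le> t \<Longrightarrow> \<not> near s M x y" using near_separates[OF assms] by metis
  obtain N where "r ^ N \<le> t" using power_arbitrarily_small[OF t(1)] by blast
  then have "\<not> N \<le> k" if "near (r ^ k) M x y" for k
    using that t(2) power_antimono order_trans by blast
  then show thesis using that[of N] by fastforce
qed

text \<open>\<open>N x y\<close> is the last level at which \<open>x\<close> and \<open>y\<close>
  are joined by \<open>M\<close> links. By \<open>contr\<close>, \<open>r ^ N\<close> satisfies the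
  three-step inequality with constant \<open>r powr (- n)\<close>; a power \<open>\<alpha>\<close>
  small enough brings this constant below 2, as \<open>quasi_ultrametric_metrizable\<close>
  requires.\<close>

lemma contraction_imp_metric:
  assumes contr: "\<forall>k x y. near (r ^ k) (3 * M + 2) x y \<longrightarrow> near (r ^ (k - n)) M x y"
  obtains d \<alpha> a b where "Metric_space S d" "0 < \<alpha>" "0 < a" "0 < b"
    "\<And>x y. \<lbrakk>x \<in> S; y \<in> S\<rbrakk> \<Longrightarrow> d x y \<le> 1"
    "\<And>x y t. \<lbrakk>x \<in> S; y \<in> S; 0 < t; near t M x y\<rbrakk> \<Longrightarrow> d x y < a * t powr \<alpha>"
    "\<And>x y t. \<lbrakk>x \<in> S; y \<in> S; 0 < t; d x y < b * t powr \<alpha>\<rbrakk> \<Longrightarrow> near t M x y"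
proof -
  \<comment> \<open>For \<open>x = y\<close> the admissible levels are unbounded and
    \<open>N\<close> carries no information; \<open>q\<close> treats that case apart.\<close>
  define N where "N x y = (GREATEST k. near (r ^ k) M x y)" for x y
  have near_N: "near (r ^ k) M x y \<longleftrightarrow> k \<le> N x y" if xy: "x \<in> S" "y \<in> S" "x \<noteq> y" for x y k
  proof -
    obtain B where B: "\<And>k. near (r ^ k) M x y \<Longrightarrow> k \<le> B" using near_level_bounded[OF xy] by blast
    have "near (r ^ N x y) M x y"
      unfolding N_def by (rule GreatestI_nat[of "\<lambda>k. near (r ^ k) M x y" 0, OF near_1[OF xy(1,2)]]) (use B in blast)
    moreover have "near (r ^ k) M x y \<Longrightarrow> k \<le> N x y"
      unfolding N_def by (rule Greatest_le_nat) (use B in blast)+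
    ultimately show ?thesis using near_up power_antimono by blast
  qed
  \<comment> \<open>This solves \<open>r powr (\<alpha> * Suc n) = 1/2\<close>; \<open>Suc n\<close>
    avoids a division by zero when \<open>n = 0\<close>.\<close>
  define \<alpha> where "\<alpha> = log r (1 / 2) / real (Suc n)"
  have "0 < ln (1 / 2) / ln r" using r_pos r_less by (intro divide_neg_neg) auto
  then have \<alpha>: "0 < \<alpha>" unfolding \<alpha>_def log_def by (rule divide_pos_pos) simp
  have "r powr (\<alpha> * real (Suc n)) = 1 / 2" using r_pos r_less by (simp add: \<alpha>_def del: of_nat_Suc)
  moreover have "r powr (\<alpha> * real (Suc n)) \<le> r powr (\<alpha> * real n)"
    using \<alpha> r_pos r_less by (intro powr_mono') auto
  ultimately have half: "1 / 2 \<le> r powr (\<alpha> * real n)" by simp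
  define q where "q x y = (if x = y then 0 else r powr (\<alpha> * real (N x y)))" for x y
  have q_le: "q x y \<le> r powr (\<alpha> * real k) \<longleftrightarrow> near (r ^ k) M x y" if "x \<in> S" "y \<in> S" for x y k
  proof (cases "x = y")
    case True
    then show ?thesis using near_refl[OF that(1)] r_pos by (simp add: q_def)
  next
    case False
    have "q x y \<le> r powr (\<alpha> * real k) \<longleftrightarrow> \<alpha> * real k \<le> \<alpha> * real (N x y)"
      using False powr_less_iff_base_less_1[OF r_pos r_less] by (simp add: q_def not_less[symmetric])
    with False \<alpha> near_N[OF that] show ?thesis by simp
  qed
  have q_pos: "0 < q x y" if "x \<noteq> y" for x y using that r_pos by (simp add: q_def)
  have q_nonneg: "0 \<le> q x y" for x y by (simp add: q_def)
  have q_le_1: "q x y \<le> 1" if "x \<in> S" "y \<in> S" for x y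
    using q_le[OF that, of 0] near_1[OF that] r_pos by simp
  have three: "q x w \<le> 2 * Max {q x y, q y z, q z w}"
    if S: "x \<in> S" "y \<in> S" "z \<in> S" "w \<in> S" for x y z w
  proof (cases "x = w")
    case True
    have "q x y \<le> Max {q x y, q y z, q z w}" by simp
    with q_nonneg[of x y] True show ?thesis by (simp add: q_def)
  next
    case False
    define m where "m = Max {q x y, q y z, q z w}"
    have m_in: "m \<in> {q x y, q y z, q z w}" unfolding m_def by (rule Max_in) auto
    have m_ge: "q x y \<le> m" "q y z \<le> m" "q z w \<le> m" by (simp_all add: m_def)
    have "m \<noteq> 0"
    proof
      assume "m = 0"
      then have "x = y" "y = z" "z = w" using m_ge q_pos by (metis not_less)+
      with False show False by simp
    qed
    \<comment> \<open>The maximum is one of the three values and is nonzero, hence an exact power,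
      and all three pairs are joined at this common level.\<close>
    then obtain k where k: "m = r powr (\<alpha> * real k)" using m_in by (auto simp: q_def split: if_splits)
    have "near (r ^ k) M x y" "near (r ^ k) M y z" "near (r ^ k) M z w"
      using m_ge q_le S unfolding k by blast+
    then have "near (r ^ k) (Suc (Suc (M + M) + M)) x w" by (blast intro: near_trans)
    moreover have "Suc (Suc (M + M) + M) = 3 * M + 2" by simp
    ultimately have "near (r ^ (k - n)) M x w" using contr by metis
    then have "q x w \<le> r powr (\<alpha> * real (k - n))" using q_le S by blast
    also have "\<dots> \<le> r powr (\<alpha> * real k - \<alpha> * real n)"
      using \<alpha> r_pos r_less by (intro powr_mono') (auto simp: right_diff_distrib[symmetric])
    also have "\<dots> = m / r powr (\<alpha> * real n)" by (simp add: powr_diff k)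
    also have "\<dots> \<le> m / (1 / 2)" using half k by (intro divide_left_mono) auto
    finally show ?thesis unfolding m_def by simp
  qed
  obtain d where d: "Metric_space S d" and d_le: "\<And>x y. \<lbrakk>x \<in> S; y \<in> S\<rbrakk> \<Longrightarrow> d x y \<le> q x y"
    and le_d: "\<And>x y. \<lbrakk>x \<in> S; y \<in> S\<rbrakk> \<Longrightarrow> q x y \<le> 2 * d x y"
  proof (rule quasi_ultrametric_metrizable[of S q])
    show "q x y = 0 \<longleftrightarrow> x = y" for x y using q_pos[of x y] by (cases "x = y") (auto simp: q_def)
    have "near (r ^ k) M x y \<longleftrightarrow> near (r ^ k) M y x" for k x y using near_sym by blast
    then show "q x y = q y x" for x y by (simp add: q_def N_def)
  qed (use q_nonneg three in blast)+
  \<comment> \<open>The factors \<open>r powr (- \<alpha>)\<close> and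
    \<open>r powr \<alpha>\<close> pay for rounding \<open>t\<close> to a power of \<open>r\<close>.
    The 2 in \<open>a\<close> makes the inequality strict; the 2 in \<open>b\<close> compensates
    \<open>q \<le> 2 * d\<close>.\<close>
  define a where "a = 2 * r powr (- \<alpha>)"
  define b where "b = r powr \<alpha> / 2"
  have ab: "0 < a" "0 < b" using r_pos by (simp_all add: a_def b_def)
  have pow: "r powr (\<alpha> * real k) = (r ^ k) powr \<alpha>" for k
    using r_pos by (simp add: powr_powr mult.commute flip: powr_realpow)
  have pow_Suc: "(r ^ Suc k) powr \<alpha> = r powr \<alpha> * (r ^ k) powr \<alpha>" for k
    using r_pos by (simp add: power_Suc powr_mult)
  have near_lt: "d x y < a * t powr \<alpha>" if xy: "x \<in> S" "y \<in> S" "0 < t" "near t M x y" for x y t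
  proof -
    \<comment> \<open>\<open>power_bracket\<close> needs a scale at most 1, and at scale 1 all
      points are joined.\<close>
    define s where "s = min t 1"
    obtain k where k: "s \<le> r ^ k" "r ^ Suc k < s"
      using power_bracket[OF r_pos r_less, of s] xy(3) by (auto simp: s_def)
    have "near s M x y" using xy near_1[OF xy(1,2)] by (auto simp: s_def min_def)
    then have "d x y \<le> (r ^ k) powr \<alpha>"
      using d_le[OF xy(1,2)] q_le[OF xy(1,2), of k] near_up[OF _ k(1)] by (simp add: pow)
    also have "\<dots> = r powr (- \<alpha>) * (r ^ Suc k) powr \<alpha>"
      using r_pos by (simp add: pow_Suc powr_minus field_simps)
    also have "\<dots> \<le> r powr (- \<alpha>) * t powr \<alpha>"
      using k(2) r_pos \<alpha> by (intro mult_left_mono powr_mono2) (auto simp: s_def)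
    also have "\<dots> < a * t powr \<alpha>" using r_pos xy(3) by (simp add: a_def)
    finally show ?thesis .
  qed
  have lt_near: "near t M x y" if xy: "x \<in> S" "y \<in> S" "0 < t" "d x y < b * t powr \<alpha>" for x y t
  proof (cases "t \<ge> 1")
    case True
    then show ?thesis using near_ge_1 xy by blast
  next
    case False
    then obtain k where k: "t \<le> r ^ k" "r ^ Suc k < t"
      using power_bracket[OF r_pos r_less xy(3)] by auto
    have "q x y \<le> 2 * (b * t powr \<alpha>)" using le_d[OF xy(1,2)] xy(4) by linarith
    also have "\<dots> \<le> r powr \<alpha> * (r ^ k) powr \<alpha>"
      using k(1) xy(3) \<alpha> by (simp add: b_def powr_mono2 mult_left_mono)
    also have "\<dots> = r powr (\<alpha> * real (Suc k))" using pow[of "Suc k"] pow_Suc[of k] by simp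
    finally have "near (r ^ Suc k) M x y" using q_le[OF xy(1,2)] by blast
    then show ?thesis using near_up k(2) by (meson less_imp_le)
  qed
  have "d x y \<le> 1" if "x \<in> S" "y \<in> S" for x y using d_le[OF that] q_le_1[OF that] by linarith
  with that[OF d \<alpha> ab] near_lt lt_near show thesis by blast
qed

lemma unit_metric_scaling:
  assumes d: "Metric_space S d" and le: "\<And>x y. \<lbrakk>x \<in> S; y \<in> S\<rbrakk> \<Longrightarrow> d x y \<le> C"
    and "x\<^sub>0 \<in> S" "y\<^sub>0 \<in> S" "x\<^sub>0 \<noteq> y\<^sub>0"
  obtains c where "0 < c" "Metric_space S (\<lambda>x y. d x y / c)" "(SUP (x, y)\<in>S \<times> S. d x y / c) = 1"
proof -
  interpret Metric_space S d by (rule d)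
  define f where "f p = (case p of (x, y) \<Rightarrow> d x y)" for p
  define c where "c = (SUP p\<in>S \<times> S. f p)"
  have ne: "S \<times> S \<noteq> {}" using assms(3) by blast
  have "bdd_above (f ` (S \<times> S))" using le by (auto simp: f_def intro!: bdd_aboveI[of _ C])
  then have f_le: "f p \<le> c" if "p \<in> S \<times> S" for p unfolding c_def using that by (intro cSUP_upper)
  have "0 < d x\<^sub>0 y\<^sub>0" using assms(3-5) by simp
  moreover have "d x\<^sub>0 y\<^sub>0 \<le> c" using f_le[of "(x\<^sub>0, y\<^sub>0)"] assms(3,4) by (simp add: f_def)
  ultimately have c: "0 < c" by linarith
  have bdd': "bdd_above ((\<lambda>p. f p / c) ` (S \<times> S))"
    using f_le c by (intro bdd_aboveI[of _ 1]) auto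
  have "(SUP p\<in>S \<times> S. f p / c) = 1"
  proof (rule antisym)
    show "(SUP p\<in>S \<times> S. f p / c) \<le> 1"
      by (rule cSUP_least[OF ne]) (use f_le c in simp)
    have "f p \<le> (SUP p\<in>S \<times> S. f p / c) * c" if "p \<in> S \<times> S" for p
      using cSUP_upper[OF that bdd'] c by (simp add: pos_divide_le_eq)
    then have "c \<le> (SUP p\<in>S \<times> S. f p / c) * c" unfolding c_def[symmetric]
      by (subst (1) c_def) (rule cSUP_least[OF ne])
    then show "1 \<le> (SUP p\<in>S \<times> S. f p / c)" using c by simp
  qed
  moreover have "(\<lambda>(x, y). d x y / c) = (\<lambda>p. f p / c)" by (auto simp: f_def)
  moreover have "Metric_space S (\<lambda>x y. d x y / c)"
    using c triangle commute by unfold_locales (auto simp: add_divide_distrib[symmetric] divide_right_mono)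
  ultimately show thesis using that c by metis
qed

lemma hyperbolic_imp_adapted:
  assumes "hyperbolic_resolution T A \<phi> K g r" and no_isolated: "\<forall>x\<in>S. \<not> openin X {x}"
  shows "\<exists>M\<ge>1. \<exists>d\<in>unit_metrics X. \<exists>\<alpha>>0. adapted X T A \<phi> K M d (\<lambda>w. g w powr \<alpha>)"
proof -
  obtain M n where "1 \<le> M" and contr: "\<forall>k x y. near (r ^ k) (3 * M + 2) x y \<longrightarrow> near (r ^ (k - n)) M x y"
    using hyperbolic_contraction[OF assms(1)] by metis
  obtain d \<alpha> a b where d: "Metric_space S d" "0 < \<alpha>" "0 < a" "0 < b"
    and le: "\<And>x y. \<lbrakk>x \<in> S; y \<in> S\<rbrakk> \<Longrightarrow> d x y \<le> 1"
    and near: "\<And>x y t. \<lbrakk>x \<in> S; y \<in> S; 0 < t; near t M x y\<rbrakk> \<Longrightarrow> d x y < a * t powr \<alpha>"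
    and ball: "\<And>x y t. \<lbrakk>x \<in> S; y \<in> S; 0 < t; d x y < b * t powr \<alpha>\<rbrakk> \<Longrightarrow> near t M x y"
    by (rule contraction_imp_metric[OF contr]) blast
  obtain x\<^sub>0 where x\<^sub>0: "x\<^sub>0 \<in> S" using K_not_empty[OF root_in] K_root by blast
  \<comment> \<open>The singleton of a one-point space is open, so the absence of isolated points
    supplies the second point that normalizing the diameter requires.\<close>
  have "S \<noteq> {x\<^sub>0}" using no_isolated x\<^sub>0 openin_topspace by metis
  then obtain y\<^sub>0 where y\<^sub>0: "y\<^sub>0 \<in> S" "x\<^sub>0 \<noteq> y\<^sub>0" using x\<^sub>0 by blast
  obtain c where c: "0 < c" "Metric_space S (\<lambda>x y. d x y / c)" "(SUP (x, y)\<in>S \<times> S. d x y / c) = 1"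
    using unit_metric_scaling[OF d(1) le x\<^sub>0 y\<^sub>0] by metis
  have near': "d x y / c < a / c * t powr \<alpha>" if "x \<in> S" "y \<in> S" "0 < t" "near t M x y" for x y t
    using near[OF that] c(1) by (simp add: divide_strict_right_mono)
  have ball': "near t M x y" if "x \<in> S" "y \<in> S" "0 < t" "d x y / c < b / c * t powr \<alpha>" for x y t
    using ball[OF that(1-3)] that(4) c(1) by (simp add: divide_less_cancel)
  have ab: "0 < a / c" "0 < b / c" using c d by simp_all
  have "Metric_space.mtopology S (\<lambda>x y. d x y / c) = X"
    by (rule mtopology_eqI[OF c(2) d(2) ab near' ball'])
  then have "(\<lambda>x y. d x y / c) \<in> unit_metrics X" using c by (simp add: unit_metrics_def)
  moreover have "adapted X T A \<phi> K M (\<lambda>x y. d x y / c) (\<lambda>w. g w powr \<alpha>)"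
    unfolding adapted_powr_iff[OF d(2) c(2)] using ab near' ball' by blast
  ultimately show ?thesis using \<open>1 \<le> M\<close> d(2) by blast
qed

end

section \<open>The equivalences and the boundary estimate\<close>

theorem theorem7p12:
  fixes X :: "'x topology"
    and T :: "'t set" and A :: "'t \<Rightarrow> 't \<Rightarrow> nat" and \<phi> :: 't
    and K :: "'t \<Rightarrow> 'x set" and g :: "'t \<Rightarrow> real"
  assumes "compact_space X" and "metrizable_space X"
    and "\<forall>x\<in>topspace X. \<not> openin X {x}"
    and "reference_tree T A \<phi>"
    and "partition_of X T A \<phi> K"
    and "g \<in> weight_functions T A \<phi>"
  defines "cond1 \<equiv> \<lambda>M. \<exists>d\<in>unit_metrics X. \<exists>\<alpha>>0. adapted X T A \<phi> K M d (\<lambda>w. g w powr \<alpha>)"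
  shows "((\<exists>M\<ge>1. cond1 M) \<longleftrightarrow> hyperbolic_weight T A \<phi> K g)
    \<and> (hyperbolic_weight T A \<phi> K g \<longleftrightarrow> (\<forall>r\<in>{0<..<1}. hyperbolic_resolution T A \<phi> K g r))
    \<and> ((\<exists>M\<ge>1. cond1 M) \<or> hyperbolic_weight T A \<phi> K g
          \<or> (\<forall>r\<in>{0<..<1}. hyperbolic_resolution T A \<phi> K g r) \<longrightarrow>
       (\<forall>M\<ge>1. cond1 M \<longrightarrow>
         (\<forall>r\<in>{0<..<1}. \<exists>c\<^sub>1>0. \<exists>c\<^sub>2>0. \<forall>x\<in>topspace X. \<forall>y\<in>topspace X.
            c\<^sub>1 * delta X T A \<phi> K g M x y \<le> epowr r (boundary_product T A \<phi> K g r x y) \<and>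
            epowr r (boundary_product T A \<phi> K g r x y) \<le> c\<^sub>2 * delta X T A \<phi> K g M x y)))"
proof -
  have res: "weighted_resolution T A \<phi> X K g r" if "r \<in> {0<..<1}" for r
    using assms that by unfold_locales auto
  have hyp: "hyperbolic_resolution T A \<phi> K g r" if M: "cond1 M" and r: "r \<in> {0<..<1}" for M r
  proof -
    obtain d \<alpha> where "Metric_space (topspace X) d" "0 < \<alpha>" "adapted X T A \<phi> K M d (\<lambda>w. g w powr \<alpha>)"
      using M unfolding cond1_def unit_metrics_def by blast
    then show ?thesis by (rule weighted_resolution.adapted_imp_hyperbolic[OF res[OF r]])
  qed
  \<comment> \<open>Condition (1) does not mention \<open>r\<close>, so hyperbolicity for one
    \<open>r\<close> passes through it to every other.\<close>
  have metric: "\<exists>M\<ge>1. cond1 M" if "r \<in> {0<..<1}" "hyperbolic_resolution T A \<phi> K g r" for r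
    unfolding cond1_def
    by (rule weighted_resolution.hyperbolic_imp_adapted[OF res[OF that(1)] that(2) assms(3)])
  \<comment> \<open>A sample value of \<open>r\<close>, needed to get from every \<open>r\<close> to
    some \<open>r\<close>.\<close>
  have half: "(1 / 2 :: real) \<in> {0<..<1}" by simp
  have product: "\<exists>c\<^sub>1>0. \<exists>c\<^sub>2>0. \<forall>x\<in>topspace X. \<forall>y\<in>topspace X.
            c\<^sub>1 * delta X T A \<phi> K g M x y \<le> epowr r (boundary_product T A \<phi> K g r x y) \<and>
            epowr r (boundary_product T A \<phi> K g r x y) \<le> c\<^sub>2 * delta X T A \<phi> K g M x y"
    if M: "cond1 M" and r: "r \<in> {0<..<1}" for M r
  proof -
    obtain d \<alpha> where "Metric_space (topspace X) d" "0 < \<alpha>" "adapted X T A \<phi> K M d (\<lambda>w. g w powr \<alpha>)"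
      using M unfolding cond1_def unit_metrics_def by blast
    then show ?thesis by (rule weighted_resolution.adapted_boundary_product[OF res[OF r]])
  qed
  show ?thesis
    unfolding hyperbolic_weight_def
    using hyp metric half product by (intro conjI iffI impI allI ballI) blast+
qed

end
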